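(* Let $E$ be a regular (a,b)-module, and assume that there exist a complex number $\delta$ and an isomorphism of (a,b)-modules $\kappa:\check E\to \mathrm{Hom}_{a,b}(E,E_\delta)$. Let $F$ be the biggest simple pole sub-(a,b)-module of $E$, and let $\tilde E$ be the saturation of $E$ by $b^{-1}a$. Then there are natural isomorphisms of (a,b)-modules deduced from $\kappa$: $$\kappa':\check{\tilde E}\to \mathrm{Hom}_{a,b}(F,E_\delta)\qquad\text{and}\qquad \kappa'':\check F\to \mathrm{Hom}_{a,b}(\tilde E,E_\delta).$$
   Context: An (a,b)-module is a free $\mathbb{C}[[b]]$-module $E$ of finite rank with a $\mathbb{C}$-linear endomorphism $a$ satisfying $ab-ba=b^2$. Morphisms are $\mathbb{C}[[b]]$-linear maps commuting with $a$. A sub-(a,b)-module is a $\mathbb{C}[[b]]$-submodule stable under $a$. $E$ has a simple pole if $aE\subset bE$. $E$ is regular if it can be embedded in a simple pole (a,b)-module; equivalently, its saturation $\tilde E=\sum_{k\ge0}(b^{-1}a)^kE\subset E[b^{-1}]$ is finitely generated over $\mathbb{C}[[b]]$. In that case $\tilde E$ is the smallest simple pole (a,b)-module in $E[b^{-1}]$ containing $E$. The biggest simple pole sub-(a,b)-module $F$ of $E$ is the largest sub-(a,b)-module of $E$ having a simple pole. $\check E$ denotes the (a,b)-module with the same underlying vector space as $E$, on which "$a$" and "$b$" act as $-a$ and $-b$. For $\delta\in\mathbb{C}$, $E_\delta=\mathbb{C}[[b]]e_\delta$ is the rank one (a,b)-module with $a\,e_\delta=\delta\, b\,e_\delta$.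 For (a,b)-modules $E,G$, $\mathrm{Hom}_{a,b}(E,G)$ is the free $\mathbb{C}[[b]]$-module $\mathrm{Hom}_{\mathbb{C}[[b]]}(E,G)$ with the action $(a\cdot\varphi)(x)=a_G\varphi(x)-\varphi(a_Ex)$, which makes it an (a,b)-module. "Natural, deduced from $\kappa$" means compatible with $\kappa$ through the inclusions $F\subset E\subset\tilde E$: $\kappa'(x)=\kappa(x)|_F$ for $x\in E$, and $\kappa''(u)|_E=\kappa(u)$ for $u\in F$. *)

theory Defs
  imports
    "HOL-Algebra.Algebraic_Closure_Type"
    "HOL-Computational_Algebra.Formal_Power_Series"
begin

text \<open>The ring of formal power series in \<open>b\<close> over the complex numbers; \<open>b\<close> is \<^term>\<open>fps_X\<close>.\<close>

abbreviation fps_ring :: "complex fps ring"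
  where "fps_ring \<equiv> ring_of_type_algebra"

text \<open>
  The fields \<^const>\<open>monoid.mult\<close> and \<^const>\<open>monoid.one\<close>, which the library's module record inherits
  from rings, play no role for modules and are left undefined below.
\<close>

record 'e ab_mod = "(complex fps, 'e) module" +
  a_op :: "'e \<Rightarrow> 'e"

definition b_op :: "'e ab_mod \<Rightarrow> 'e \<Rightarrow> 'e"
  where "b_op E x = fps_X \<odot>\<^bsub>E\<^esub> x"

definition free_of_finite_rank :: "'e ab_mod \<Rightarrow> bool"
  where "free_of_finite_rank E \<longleftrightarrow>
    (\<exists>(n::nat) e. e \<in> {..<n} \<rightarrow> carrier E \<and>
       (\<forall>x\<in>carrier E. \<exists>!c. c \<in> {..<n} \<rightarrow>\<^sub>E (UNIV :: complex fps set) \<and>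
          x = (\<Oplus>\<^bsub>E\<^esub>i\<in>{..<n}. c i \<odot>\<^bsub>E\<^esub> e i)))"

locale ab_module = module fps_ring E for E :: "'e ab_mod" (structure) +
  assumes free: "free_of_finite_rank E"
    and a_closed: "x \<in> carrier E \<Longrightarrow> a_op E x \<in> carrier E"
    and a_add: "\<lbrakk>x \<in> carrier E; y \<in> carrier E\<rbrakk> \<Longrightarrow> a_op E (x \<oplus> y) = a_op E x \<oplus> a_op E y"
    and a_scale: "x \<in> carrier E \<Longrightarrow> a_op E (fps_const c \<odot> x) = fps_const c \<odot> a_op E x"
    and a_b_commutator:
      "x \<in> carrier E \<Longrightarrow> a_op E (b_op E x) \<ominus> b_op E (a_op E x) = b_op E (b_op E x)"

definition lin_hom :: "'e ab_mod \<Rightarrow> 'g ab_mod \<Rightarrow> ('e \<Rightarrow> 'g) set"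
  where "lin_hom E G = {f \<in> carrier E \<rightarrow> carrier G.
    (\<forall>x\<in>carrier E. \<forall>y\<in>carrier E. f (x \<oplus>\<^bsub>E\<^esub> y) = f x \<oplus>\<^bsub>G\<^esub> f y) \<and>
    (\<forall>s. \<forall>x\<in>carrier E. f (s \<odot>\<^bsub>E\<^esub> x) = s \<odot>\<^bsub>G\<^esub> f x)}"

definition ab_hom :: "'e ab_mod \<Rightarrow> 'g ab_mod \<Rightarrow> ('e \<Rightarrow> 'g) set"
  where "ab_hom E G = {f \<in> lin_hom E G. \<forall>x\<in>carrier E. f (a_op E x) = a_op G (f x)}"

definition ab_iso :: "'e ab_mod \<Rightarrow> 'g ab_mod \<Rightarrow> ('e \<Rightarrow> 'g) \<Rightarrow> bool"
  where "ab_iso E G f \<longleftrightarrow>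
    ab_module E \<and> ab_module G \<and> f \<in> ab_hom E G \<and> bij_betw f (carrier E) (carrier G)"

definition simple_pole :: "'e ab_mod \<Rightarrow> bool"
  where "simple_pole E \<longleftrightarrow> a_op E ` carrier E \<subseteq> b_op E ` carrier E"

text \<open>
  A free module of rank \<open>n\<close> is isomorphic to the space of coordinate vectors of length \<open>n\<close>, whose
  elements are functions on the naturals. Hence fixing the type of \<open>G\<close> below is no restriction:
  see lemma \<open>regularI\<close>, where the type of \<open>G\<close> is arbitrary.
\<close>

definition regular :: "'e ab_mod \<Rightarrow> bool"
  where "regular E \<longleftrightarrow>
    (\<exists>(G :: (nat \<Rightarrow> complex fps) ab_mod) f.
       ab_module G \<and> simple_pole G \<and> f \<in> ab_hom E G \<and> inj_on f (carrier E))"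

lemma cring_fps_ring: "cring fps_ring"
  by (rule cring_from_type_algebra)

lemma ab_module_transport:
  fixes G :: "'g ab_mod" and j :: "'g \<Rightarrow> 'h"
  assumes G: "ab_module G" and j: "inj_on j (carrier G)"
  defines "i \<equiv> inv_into (carrier G) j"
  defines "H \<equiv> \<lparr>carrier = j ` carrier G, monoid.mult = undefined, one = undefined,
    zero = j \<zero>\<^bsub>G\<^esub>, add = (\<lambda>u v. j (i u \<oplus>\<^bsub>G\<^esub> i v)), module.smult = (\<lambda>s u. j (s \<odot>\<^bsub>G\<^esub> i u)),
    a_op = (\<lambda>u. j (a_op G (i u)))\<rparr>"
  shows "ab_module H" "j \<in> ab_hom G H" "simple_pole G \<Longrightarrow> simple_pole H"
proof -
  interpret G: ab_module G by fact
  have ij[simp]: "x \<in> carrier G \<Longrightarrow> i (j x) = x" for x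
    using j by (simp add: i_def)
  have sc[simp]: "s \<odot>\<^bsub>G\<^esub> x \<in> carrier G" if "x \<in> carrier G" for s x
    using that by (simp add: ring_of_type_algebra_def)
  note G.a_closed[simp]
  have car: "carrier H = j ` carrier G" by (simp add: H_def)
  have z: "\<zero>\<^bsub>H\<^esub> = j \<zero>\<^bsub>G\<^esub>" by (simp add: H_def)
  have ad: "j x \<oplus>\<^bsub>H\<^esub> j y = j (x \<oplus>\<^bsub>G\<^esub> y)" if "x \<in> carrier G" "y \<in> carrier G" for x y
    using that by (simp add: H_def)
  have sm: "s \<odot>\<^bsub>H\<^esub> j x = j (s \<odot>\<^bsub>G\<^esub> x)" if "x \<in> carrier G" for s x
    using that by (simp add: H_def)
  have ao: "a_op H (j x) = j (a_op G x)" if "x \<in> carrier G" for x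
    using that by (simp add: H_def)
  have bo: "b_op H (j x) = j (b_op G x)" if "x \<in> carrier G" for x
    using that by (simp add: b_op_def sm)
  have bc[simp]: "b_op G x \<in> carrier G" if "x \<in> carrier G" for x
    using that by (simp add: b_op_def)
  have ag: "abelian_group H"
  proof (rule abelian_groupI)
    fix x assume "x \<in> carrier H"
    then obtain x' where x: "x = j x'" "x' \<in> carrier G" by (auto simp: car)
    show "\<exists>y\<in>carrier H. y \<oplus>\<^bsub>H\<^esub> x = \<zero>\<^bsub>H\<^esub>"
      by (rule bexI[of _ "j (\<ominus>\<^bsub>G\<^esub> x')"]) (use x in \<open>auto simp: car z ad G.l_neg\<close>)
  qed (auto simp: car z ad G.a_ac)
  have mo: "module fps_ring H"
    by (rule moduleI[OF cring_fps_ring ag])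
       (auto simp: car z ad sm G.smult_l_distr G.smult_r_distr G.smult_assoc1)
  interpret H: module fps_ring H by fact
  have fs: "(\<Oplus>\<^bsub>H\<^esub>k\<in>{..<n::nat}. j (g k)) = j (\<Oplus>\<^bsub>G\<^esub>k\<in>{..<n}. g k) \<and> (\<Oplus>\<^bsub>G\<^esub>k\<in>{..<n}. g k) \<in> carrier G"
    if "g \<in> {..<n} \<rightarrow> carrier G" for n g
    using that
  proof (induction n)
    case (Suc n)
    have gn: "g n \<in> carrier G" "g \<in> {..<n} \<rightarrow> carrier G" using Suc.prems by auto
    with Suc.IH show ?case
      by (auto simp: lessThan_Suc H.finsum_insert G.finsum_insert car Pi_iff ad)
  qed (simp add: z)
  have mi: "j x \<ominus>\<^bsub>H\<^esub> j y = j (x \<ominus>\<^bsub>G\<^esub> y)" if "x \<in> carrier G" "y \<in> carrier G" for x y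
  proof -
    have "j (x \<ominus>\<^bsub>G\<^esub> y) \<oplus>\<^bsub>H\<^esub> j y = j x"
      using that by (simp add: ad G.minus_eq G.a_assoc G.l_neg)
    hence "j x \<ominus>\<^bsub>H\<^esub> j y = (j (x \<ominus>\<^bsub>G\<^esub> y) \<oplus>\<^bsub>H\<^esub> j y) \<oplus>\<^bsub>H\<^esub> (\<ominus>\<^bsub>H\<^esub> j y)"
      by (simp only: H.minus_eq)
    also have "\<dots> = j (x \<ominus>\<^bsub>G\<^esub> y) \<oplus>\<^bsub>H\<^esub> (j y \<oplus>\<^bsub>H\<^esub> (\<ominus>\<^bsub>H\<^esub> j y))"
      using that by (intro H.a_assoc H.a_inv_closed) (simp_all add: car)
    also have "\<dots> = j (x \<ominus>\<^bsub>G\<^esub> y)"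
      using that by (subst H.r_neg) (simp_all add: car)
    finally show ?thesis .
  qed
  obtain n :: nat and e where e: "e \<in> {..<n} \<rightarrow> carrier G"
    and un: "\<And>x. x \<in> carrier G \<Longrightarrow> \<exists>!c. c \<in> {..<n} \<rightarrow>\<^sub>E (UNIV :: complex fps set) \<and>
          x = (\<Oplus>\<^bsub>G\<^esub>i\<in>{..<n}. c i \<odot>\<^bsub>G\<^esub> e i)"
    using G.free unfolding free_of_finite_rank_def by (elim exE conjE) (rule that, assumption, erule bspec, assumption)
  have fr: "free_of_finite_rank H"
    unfolding free_of_finite_rank_def
  proof (intro exI conjI ballI)
    show "(\<lambda>k. j (e k)) \<in> {..<n} \<rightarrow> carrier H" using e by (auto simp: car)
    fix x assume "x \<in> carrier H"
    then obtain x' where x: "x = j x'" "x' \<in> carrier G" by (auto simp: car)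
    have "(\<Oplus>\<^bsub>H\<^esub>k\<in>{..<n}. c k \<odot>\<^bsub>H\<^esub> j (e k)) = j (\<Oplus>\<^bsub>G\<^esub>k\<in>{..<n}. c k \<odot>\<^bsub>G\<^esub> e k) \<and>
      (\<Oplus>\<^bsub>G\<^esub>k\<in>{..<n}. c k \<odot>\<^bsub>G\<^esub> e k) \<in> carrier G" for c
    proof -
      have "(\<Oplus>\<^bsub>H\<^esub>k\<in>{..<n}. c k \<odot>\<^bsub>H\<^esub> j (e k)) = (\<Oplus>\<^bsub>H\<^esub>k\<in>{..<n}. j (c k \<odot>\<^bsub>G\<^esub> e k))"
        by (rule H.finsum_cong') (use e in \<open>auto simp: car sm Pi_iff\<close>)
      thus ?thesis using fs[of "\<lambda>k. c k \<odot>\<^bsub>G\<^esub> e k" n] e by (auto simp: Pi_iff)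
    qed
    hence "x = (\<Oplus>\<^bsub>H\<^esub>k\<in>{..<n}. c k \<odot>\<^bsub>H\<^esub> j (e k)) \<longleftrightarrow> x' = (\<Oplus>\<^bsub>G\<^esub>k\<in>{..<n}. c k \<odot>\<^bsub>G\<^esub> e k)" for c
      using j x by (auto simp: inj_on_eq_iff)
    thus "\<exists>!c. c \<in> {..<n} \<rightarrow>\<^sub>E (UNIV :: complex fps set) \<and>
          x = (\<Oplus>\<^bsub>H\<^esub>i\<in>{..<n}. c i \<odot>\<^bsub>H\<^esub> j (e i))" using un[OF x(2)] by simp
  qed
  show "ab_module H"
  proof unfold_locales
    show "free_of_finite_rank H" by (rule fr)
  qed (auto simp: car ad sm ao bo mi G.a_add G.a_scale G.a_b_commutator)
  show "j \<in> ab_hom G H" by (auto simp: ab_hom_def lin_hom_def car ad sm ao)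
  assume sp: "simple_pole G"
  show "simple_pole H" unfolding simple_pole_def
  proof clarify
    fix u assume "u \<in> carrier H"
    then obtain x where x: "u = j x" "x \<in> carrier G" by (auto simp: car)
    then obtain y where y: "y \<in> carrier G" "a_op G x = b_op G y"
      using sp by (auto simp: simple_pole_def)
    thus "a_op H u \<in> b_op H ` carrier H" using x by (auto simp: car ao bo intro!: image_eqI[of _ _ "j y"])
  qed
qed

lemma regularI:
  fixes E :: "'e ab_mod" and G :: "'g ab_mod"
  assumes G: "ab_module G" and sp: "simple_pole G" and f: "f \<in> ab_hom E G" "inj_on f (carrier E)"
  shows "regular E"
proof -
  interpret G: ab_module G by fact
  obtain n :: nat and e where e: "e \<in> {..<n} \<rightarrow> carrier G"
    and un: "\<And>x. x \<in> carrier G \<Longrightarrow> \<exists>!c. c \<in> {..<n} \<rightarrow>\<^sub>E (UNIV :: complex fps set) \<and>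
          x = (\<Oplus>\<^bsub>G\<^esub>i\<in>{..<n}. c i \<odot>\<^bsub>G\<^esub> e i)"
    using G.free unfolding free_of_finite_rank_def by (elim exE conjE) (rule that, assumption, erule bspec, assumption)
  define j where "j = (\<lambda>x. SOME c. c \<in> {..<n} \<rightarrow>\<^sub>E (UNIV :: complex fps set) \<and>
          x = (\<Oplus>\<^bsub>G\<^esub>i\<in>{..<n}. c i \<odot>\<^bsub>G\<^esub> e i))"
  have jx: "x = (\<Oplus>\<^bsub>G\<^esub>i\<in>{..<n}. j x i \<odot>\<^bsub>G\<^esub> e i)" if "x \<in> carrier G" for x
    using someI_ex[OF ex1_implies_ex[OF un[OF that]]] unfolding j_def by (rule conjunct2)
  have j: "inj_on j (carrier G)"
  proof (rule inj_onI)
    fix x y assume x: "x \<in> carrier G" and y: "y \<in> carrier G" and eq: "j x = j y"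
    show "x = y" by (rule trans[OF jx[OF x, unfolded eq] jx[OF y, symmetric]])
  qed
  note t = ab_module_transport[OF G j]
  have hom: "j \<circ> f \<in> ab_hom E H" if "j \<in> ab_hom G H" for H
    using f that by (auto simp: ab_hom_def lin_hom_def Pi_iff)
  have inj: "inj_on (j \<circ> f) (carrier E)"
    by (rule comp_inj_on[OF f(2) inj_on_subset[OF j]])
       (use f in \<open>auto simp: ab_hom_def lin_hom_def\<close>)
  show ?thesis
    unfolding regular_def
    by (rule exI, rule exI, intro conjI, rule t(1), rule t(3)[OF sp], rule hom[OF t(2)], rule inj)
qed

abbreviation restrict_carrier :: "'e ab_mod \<Rightarrow> 'e set \<Rightarrow> 'e ab_mod"
  where "restrict_carrier E F \<equiv> E\<lparr>carrier := F\<rparr>"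

definition sub_ab_module :: "'e set \<Rightarrow> 'e ab_mod \<Rightarrow> bool"
  where "sub_ab_module F E \<longleftrightarrow> submodule F fps_ring E \<and> a_op E ` F \<subseteq> F"

definition biggest_simple_pole_sub :: "'e set \<Rightarrow> 'e ab_mod \<Rightarrow> bool"
  where "biggest_simple_pole_sub F E \<longleftrightarrow>
    sub_ab_module F E \<and> simple_pole (restrict_carrier E F) \<and>
    (\<forall>F'. sub_ab_module F' E \<and> simple_pole (restrict_carrier E F') \<longrightarrow> F' \<subseteq> F)"

text \<open>
  On the conjugate module, \<open>b\<close> acts as \<open>-b\<close>, so a power series \<open>s(b)\<close> acts as \<open>s(-b)\<close>.
\<close>

definition ab_check :: "'e ab_mod \<Rightarrow> 'e ab_mod"
  where "ab_check E =
    E\<lparr>module.smult := (\<lambda>s x. (s oo (- fps_X)) \<odot>\<^bsub>E\<^esub> x), a_op := (\<lambda>x. \<ominus>\<^bsub>E\<^esub> a_op E x)\<rparr>"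

text \<open>
  The generator \<open>e\<close> is \<open>1\<close>. From \<open>a b - b a = b\<^sup>2\<close> one gets \<open>a s - s a = b\<^sup>2 s'\<close> for
  every power series \<open>s\<close>, so that \<open>a e = \<delta> b e\<close> forces \<open>a (s e) = (\<delta> b s + b\<^sup>2 s') e\<close>.
\<close>

definition ab_rank1 :: "complex \<Rightarrow> complex fps ab_mod"
  where "ab_rank1 \<delta> =
    \<lparr>carrier = UNIV, monoid.mult = undefined, one = undefined, zero = 0, add = (+), module.smult = (*),
     a_op = (\<lambda>s. fps_const \<delta> * fps_X * s + fps_X ^ 2 * fps_deriv s)\<rparr>"

lemma minus_ab_rank1: "x \<ominus>\<^bsub>ab_rank1 d\<^esub> y = x - y"
proof -
  have "(THE z. y + z = 0 \<and> z + y = 0) = - y"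
    by (rule the_equality) (simp, blast dest: minus_unique[symmetric])
  thus ?thesis by (simp add: ab_rank1_def a_minus_def a_inv_def m_inv_def)
qed

lemma ab_module_ab_rank1: "ab_module (ab_rank1 d)"
proof -
  have ag: "abelian_group (ab_rank1 d)"
  proof (rule abelian_groupI)
    fix x :: "complex fps"
    show "\<exists>y\<in>carrier (ab_rank1 d). y \<oplus>\<^bsub>ab_rank1 d\<^esub> x = \<zero>\<^bsub>ab_rank1 d\<^esub>"
      by (rule bexI[of _ "-x"]) (auto simp: ab_rank1_def)
  qed (simp_all add: ab_rank1_def add.assoc add.commute)
  have m: "module fps_ring (ab_rank1 d)"
    by (rule moduleI[OF cring_fps_ring ag])
      (simp_all add: ab_rank1_def ring_of_type_algebra_def distrib_left distrib_right mult.assoc)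
  interpret M: module fps_ring "ab_rank1 d" by fact
  have fsum: "(\<Oplus>\<^bsub>ab_rank1 d\<^esub>i\<in>{..<Suc 0}. g i) = g 0" for g
  proof -
    have c: "carrier (ab_rank1 d) = UNIV" by (simp add: ab_rank1_def)
    have "(\<Oplus>\<^bsub>ab_rank1 d\<^esub>i\<in>{..<Suc 0}. g i) = g 0 \<oplus>\<^bsub>ab_rank1 d\<^esub> \<zero>\<^bsub>ab_rank1 d\<^esub>"
      using M.finsum_insert[of "{}" "0::nat" g] by (simp add: lessThan_Suc c)
    thus ?thesis by (simp add: ab_rank1_def)
  qed
  have f: "free_of_finite_rank (ab_rank1 d)"
    unfolding free_of_finite_rank_def
  proof (rule exI[of _ "Suc 0"], rule exI[of _ "\<lambda>_. 1"], intro conjI ballI)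
    fix x
    show "\<exists>!c. c \<in> {..<Suc 0} \<rightarrow>\<^sub>E UNIV \<and> x = (\<Oplus>\<^bsub>ab_rank1 d\<^esub>i\<in>{..<Suc 0}. c i \<odot>\<^bsub>ab_rank1 d\<^esub> 1)"
      unfolding fsum
    proof (rule ex1I[of _ "\<lambda>i\<in>{..<Suc 0}. x"])
      fix c assume "c \<in> {..<Suc 0} \<rightarrow>\<^sub>E UNIV \<and> x = c 0 \<odot>\<^bsub>ab_rank1 d\<^esub> 1"
      hence "c \<in> extensional {..<Suc 0}" "x = c 0" by (simp_all add: ab_rank1_def PiE_def)
      thus "c = (\<lambda>i\<in>{..<Suc 0}. x)" by (intro ext) (simp add: extensional_def)
    qed (simp add: ab_rank1_def)
  qed (auto simp: ab_rank1_def)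
  show ?thesis
  proof
    show "free_of_finite_rank (ab_rank1 d)" by (rule f)
  next
    fix x
    show "a_op (ab_rank1 d) (b_op (ab_rank1 d) x) \<ominus>\<^bsub>ab_rank1 d\<^esub> b_op (ab_rank1 d) (a_op (ab_rank1 d) x) =
        b_op (ab_rank1 d) (b_op (ab_rank1 d) x)"
      unfolding minus_ab_rank1
      by (simp add: ab_rank1_def b_op_def power2_eq_square distrib_left mult.left_commute)
  qed (simp_all add: ab_rank1_def distrib_left mult.left_commute)
qed

lemma a_op_generator: "a_op (ab_rank1 d) 1 = fps_const d \<odot>\<^bsub>ab_rank1 d\<^esub> b_op (ab_rank1 d) 1"
  by (simp add: ab_rank1_def b_op_def)

definition ab_Hom :: "'e ab_mod \<Rightarrow> 'g ab_mod \<Rightarrow> ('e \<Rightarrow> 'g) ab_mod"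
  where "ab_Hom E G =
    \<lparr>carrier = lin_hom E G \<inter> extensional (carrier E),
     monoid.mult = undefined, one = undefined,
     zero = (\<lambda>x\<in>carrier E. \<zero>\<^bsub>G\<^esub>),
     add = (\<lambda>\<phi> \<psi>. \<lambda>x\<in>carrier E. \<phi> x \<oplus>\<^bsub>G\<^esub> \<psi> x),
     module.smult = (\<lambda>s \<phi>. \<lambda>x\<in>carrier E. s \<odot>\<^bsub>G\<^esub> \<phi> x),
     a_op = (\<lambda>\<phi>. \<lambda>x\<in>carrier E. a_op G (\<phi> x) \<ominus>\<^bsub>G\<^esub> \<phi> (a_op E x))\<rparr>"

text \<open>
  The localization \<open>E[b\<^sup>-\<^sup>1]\<close>: the class \<^term>\<open>loc_frac E x n\<close> of the pair \<open>(x, n)\<close> stands for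
  \<open>b\<^sup>-\<^sup>n x\<close>. The action of \<open>a\<close> comes from \<open>a b\<^sup>n = b\<^sup>n a + n b\<^sup>n\<^sup>+\<^sup>1\<close>, which gives
  \<open>a (b\<^sup>-\<^sup>n x) = b\<^sup>-\<^sup>n (a x - n b x)\<close>.
\<close>

definition loc_frac :: "'e ab_mod \<Rightarrow> 'e \<Rightarrow> nat \<Rightarrow> ('e \<times> nat) set"
  where "loc_frac E x n =
    {(y, m). y \<in> carrier E \<and> fps_X ^ m \<odot>\<^bsub>E\<^esub> x = fps_X ^ n \<odot>\<^bsub>E\<^esub> y}"

definition ab_loc :: "'e ab_mod \<Rightarrow> ('e \<times> nat) set ab_mod"
  where "ab_loc E =
    \<lparr>carrier = {loc_frac E x n | x n. x \<in> carrier E},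
     monoid.mult = undefined, one = undefined,
     zero = loc_frac E \<zero>\<^bsub>E\<^esub> 0,
     add = (\<lambda>u v. \<Union>(x, n)\<in>u. \<Union>(y, m)\<in>v.
       loc_frac E (fps_X ^ m \<odot>\<^bsub>E\<^esub> x \<oplus>\<^bsub>E\<^esub> fps_X ^ n \<odot>\<^bsub>E\<^esub> y) (n + m)),
     module.smult = (\<lambda>s u. \<Union>(x, n)\<in>u. loc_frac E (s \<odot>\<^bsub>E\<^esub> x) n),
     a_op = (\<lambda>u. \<Union>(x, n)\<in>u. loc_frac E (a_op E x \<ominus>\<^bsub>E\<^esub> of_nat n \<odot>\<^bsub>E\<^esub> b_op E x) n)\<rparr>"

definition loc_incl :: "'e ab_mod \<Rightarrow> 'e \<Rightarrow> ('e \<times> nat) set"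
  where "loc_incl E x = loc_frac E x 0"

definition loc_b_inverse :: "'e ab_mod \<Rightarrow> ('e \<times> nat) set \<Rightarrow> ('e \<times> nat) set"
  where "loc_b_inverse E u = (\<Union>(x, n)\<in>u. loc_frac E x (Suc n))"

definition saturation :: "'e ab_mod \<Rightarrow> ('e \<times> nat) set ab_mod"
  where "saturation E = restrict_carrier (ab_loc E)
    {\<Oplus>\<^bsub>ab_loc E\<^esub>k\<in>{..N}. ((\<lambda>u. loc_b_inverse E (a_op (ab_loc E) u)) ^^ k) (loc_incl E (x k))
      | (N::nat) x. x \<in> UNIV \<rightarrow> carrier E}"

end

(*
  Write B(x, y) = \<kappa>(x)(y). This is a perfect pairing of E with itself which is linear in y and, with
  s*(b) = s(-b), satisfies B(s x, y) = s* B(x, y); moreover a B(x, y) = B(x, a y) - B(a x, y).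

  For u in F write a u = b w with w in F. Then B(u, b^-1 a v) = b^-1 a B(u, v) + b^-1 B(a u, v) =
  b^-1 a B(u, v) - B(w, v), so by induction B(u, -) maps the whole saturation to power series. Conversely,
  the u for which B(u, -) extends to the saturation form a simple pole submodule, because b^-1 a acts on
  the forms on the saturation; by maximality they lie in F. This gives \<kappa>''.

  The transposed pairing (x, y) |-> B(y, x)* is again perfect and of the same kind. Applying the first
  part to it and transposing back gives \<kappa>'.
*)
theory Submission
  imports Defs
begin

section \<open>Free modules over the ring of power series\<close>

text \<open>Maximality of F tells which elements of E give forms that extend to the saturation; it
  does not tell directly whether every form on F comes from the saturation. That is why \<kappa>' is
  reached by transposing: a perfect pairing between free modules of finite rank can be turned
  around. The same \<delta> survives because conjugation anticommutes with the action of a on power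
  series, conj(a s) = - a conj(s). Transposing needs the saturation to be free of finite rank, and
  this is where regularity enters. One criterion over C[[b]] gives all freeness of submodules and of
  the saturation: finitely many linear forms whose only common zero is 0. For the saturation such
  forms are pulled back from a simple pole module in which E embeds. Conversely, the forms on a free
  module separate points, so identities in E and in E[b^-1] are mostly checked as identities of
  power series.\<close>

lemma fps_ring_simps [simp]:
  "carrier fps_ring = UNIV" "monoid.mult fps_ring = (*)" "one fps_ring = 1"
  "zero fps_ring = 0" "add fps_ring = (+)"
  by (auto simp: ring_of_type_algebra_def)

definition conj_fps :: "complex fps \<Rightarrow> complex fps"
  where "conj_fps s = s oo (- fps_X)"

lemma conj_fps_simps [simp]:
  "conj_fps (s + t) = conj_fps s + conj_fps t"
  "conj_fps (s - t) = conj_fps s - conj_fps t"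
  "conj_fps (s * t) = conj_fps s * conj_fps t"
  "conj_fps (- s) = - conj_fps s"
  "conj_fps (s ^ k) = conj_fps s ^ k"
  "conj_fps 0 = 0" "conj_fps 1 = 1" "conj_fps fps_X = - fps_X" "conj_fps (fps_const c) = fps_const c"
  "conj_fps (conj_fps s) = s"
proof -
  have X: "(- fps_X) oo (- fps_X) = (fps_X :: complex fps)"
    by (simp add: fps_compose_uminus)
  show "conj_fps (conj_fps s) = s"
    by (simp add: conj_fps_def fps_compose_assoc[symmetric] X)
qed (simp_all add: conj_fps_def fps_compose_add_distrib fps_compose_sub_distrib
    fps_compose_mult_distrib fps_compose_uminus fps_compose_power)

lemma fps_deriv_conj_fps: "fps_deriv (conj_fps s) = - conj_fps (fps_deriv s)"
  by (simp add: conj_fps_def fps_compose_deriv)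

text \<open>Neither freeness nor an action of a is assumed, so this also covers the localization,
  and submodules whose freeness is still to be proved.\<close>

locale fps_module = module fps_ring E for E :: "'e ab_mod" (structure)
begin

lemma scale_closed [simp, intro]: "x \<in> carrier E \<Longrightarrow> s \<odot> x \<in> carrier E"
  using smult_closed[of s x] by simp

lemma scale_add: "x \<in> carrier E \<Longrightarrow> (s + t) \<odot> x = s \<odot> x \<oplus> t \<odot> x"
  using smult_l_distr[of s t x] by simp

lemma scale_add_right:
  "x \<in> carrier E \<Longrightarrow> y \<in> carrier E \<Longrightarrow> s \<odot> (x \<oplus> y) = s \<odot> x \<oplus> s \<odot> y"
  using smult_r_distr[of s x y] by simp

lemma scale_scale: "x \<in> carrier E \<Longrightarrow> s \<odot> (t \<odot> x) = (s * t) \<odot> x"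
  using smult_assoc1[of s t x] by simp

lemma scale_one [simp]: "x \<in> carrier E \<Longrightarrow> 1 \<odot> x = x"
  using smult_one[of x] by simp

lemma scale_zero [simp]: "x \<in> carrier E \<Longrightarrow> 0 \<odot> x = \<zero>"
  using smult_l_null[of x] by simp

lemma scale_zero_right [simp]: "s \<odot> \<zero> = \<zero>"
  using smult_r_null[of s] by simp

lemma neg_eq: "x \<in> carrier E \<Longrightarrow> \<ominus> x = (- 1) \<odot> x"
proof -
  assume x: "x \<in> carrier E"
  have "(- 1) \<odot> x \<oplus> x = ((- 1) + 1) \<odot> x"
    using x by (subst scale_add) simp_all
  thus ?thesis using x by (intro M.minus_equality) simp_all
qed

lemma minus_eq_scale: "x \<in> carrier E \<Longrightarrow> y \<in> carrier E \<Longrightarrow> x \<ominus> y = x \<oplus> (- 1) \<odot> y"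
  by (simp add: M.minus_eq neg_eq)

lemma minus_eq_iff:
  "x \<in> carrier E \<Longrightarrow> y \<in> carrier E \<Longrightarrow> z \<in> carrier E \<Longrightarrow> x \<ominus> y = z \<longleftrightarrow> x = y \<oplus> z"
  by (metis M.minus_closed M.minus_eq M.a_comm M.add.inv_solve_right')

lemma eq_iff_diff: "x \<in> carrier E \<Longrightarrow> y \<in> carrier E \<Longrightarrow> x = y \<longleftrightarrow> x \<oplus> (- 1) \<odot> y = \<zero>"
  using minus_eq_iff[of x y \<zero>] by (simp add: minus_eq_scale)

lemma submodule_restrict:
  assumes "S \<subseteq> carrier E" "\<zero> \<in> S" "\<And>x y. x \<in> S \<Longrightarrow> y \<in> S \<Longrightarrow> x \<oplus> y \<in> S"
    "\<And>s x. x \<in> S \<Longrightarrow> s \<odot> x \<in> S"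
  shows "submodule S fps_ring E"
  by (rule submoduleI) (use assms neg_eq in auto)

lemma fps_module_restrict:
  assumes "submodule S fps_ring E"
  shows "fps_module (restrict_carrier E S)"
  by (rule fps_module.intro, rule submodule.submodule_is_module[OF assms]) (rule module_axioms)

end

text \<open>Additive inverses need no axiom: \<open>null\<close> and \<open>l_distr\<close> make
  (-1) x the inverse of x. This suits \<open>ab_loc\<close> and \<open>ab_Hom\<close>, which define
  no negation.\<close>

lemma fps_moduleI:
  fixes M :: "'e ab_mod" (structure)
  assumes zero: "\<zero> \<in> carrier M"
    and add: "\<And>x y. x \<in> carrier M \<Longrightarrow> y \<in> carrier M \<Longrightarrow> x \<oplus> y \<in> carrier M"
    and smult: "\<And>s x. x \<in> carrier M \<Longrightarrow> s \<odot> x \<in> carrier M"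
    and assoc: "\<And>x y z. x \<in> carrier M \<Longrightarrow> y \<in> carrier M \<Longrightarrow> z \<in> carrier M \<Longrightarrow> x \<oplus> y \<oplus> z = x \<oplus> (y \<oplus> z)"
    and comm: "\<And>x y. x \<in> carrier M \<Longrightarrow> y \<in> carrier M \<Longrightarrow> x \<oplus> y = y \<oplus> x"
    and l_zero: "\<And>x. x \<in> carrier M \<Longrightarrow> \<zero> \<oplus> x = x"
    and l_distr: "\<And>s t x. x \<in> carrier M \<Longrightarrow> (s + t) \<odot> x = s \<odot> x \<oplus> t \<odot> x"
    and r_distr: "\<And>s x y. x \<in> carrier M \<Longrightarrow> y \<in> carrier M \<Longrightarrow> s \<odot> (x \<oplus> y) = s \<odot> x \<oplus> s \<odot> y"
    and smult_assoc: "\<And>s t x. x \<in> carrier M \<Longrightarrow> (s * t) \<odot> x = s \<odot> (t \<odot> x)"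
    and one: "\<And>x. x \<in> carrier M \<Longrightarrow> 1 \<odot> x = x"
    and null: "\<And>x. x \<in> carrier M \<Longrightarrow> 0 \<odot> x = \<zero>"
  shows "fps_module M"
proof (rule fps_module.intro, rule moduleI[OF cring_fps_ring])
  show "abelian_group M"
  proof (rule abelian_groupI)
    fix x assume x: "x \<in> carrier M"
    have "(- 1) \<odot> x \<oplus> x = ((- 1) + 1) \<odot> x" using l_distr[OF x, of "-1" 1] one[OF x] by simp
    also have "\<dots> = \<zero>" using null[OF x] by simp
    finally show "\<exists>y\<in>carrier M. y \<oplus> x = \<zero>" using smult[OF x] by blast
  qed (use assms in auto)
qed (use assms in auto)

section \<open>Linear forms, dual bases and freeness over C[[b]]\<close>

definition lin_form :: "'e ab_mod \<Rightarrow> ('e \<Rightarrow> complex fps) \<Rightarrow> bool"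
  where "lin_form E f \<longleftrightarrow>
    (\<forall>x\<in>carrier E. \<forall>y\<in>carrier E. f (x \<oplus>\<^bsub>E\<^esub> y) = f x + f y) \<and>
    (\<forall>s. \<forall>x\<in>carrier E. f (s \<odot>\<^bsub>E\<^esub> x) = s * f x)"

lemma lin_form_add: "lin_form E f \<Longrightarrow> x \<in> carrier E \<Longrightarrow> y \<in> carrier E \<Longrightarrow> f (x \<oplus>\<^bsub>E\<^esub> y) = f x + f y"
  and lin_form_smult: "lin_form E f \<Longrightarrow> x \<in> carrier E \<Longrightarrow> f (s \<odot>\<^bsub>E\<^esub> x) = s * f x"
  by (auto simp: lin_form_def)

lemma lin_formI:
  assumes "\<And>x y. x \<in> carrier E \<Longrightarrow> y \<in> carrier E \<Longrightarrow> f (x \<oplus>\<^bsub>E\<^esub> y) = f x + f y"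
    and "\<And>s x. x \<in> carrier E \<Longrightarrow> f (s \<odot>\<^bsub>E\<^esub> x) = s * f x"
  shows "lin_form E f"
  using assms by (auto simp: lin_form_def)

lemma ab_rank1_simps [simp]:
  "carrier (ab_rank1 d) = UNIV" "add (ab_rank1 d) = (+)" "module.smult (ab_rank1 d) = (*)"
  "zero (ab_rank1 d) = 0"
  by (auto simp: ab_rank1_def)

lemma lin_hom_ab_rank1: "f \<in> lin_hom E (ab_rank1 d) \<longleftrightarrow> lin_form E f"
  by (auto simp: lin_hom_def lin_form_def)

lemma lin_form_comp: "f \<in> lin_hom E G \<Longrightarrow> lin_form G p \<Longrightarrow> lin_form E (\<lambda>x. p (f x))"
  by (auto simp: lin_hom_def lin_form_def Pi_iff)

text \<open>A basis together with its coordinate forms. That the \<open>e i\<close> generate is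
  encoded by joint injectivity of the coordinates, which is easier to verify; the expansion is
  recovered in \<open>dual_bases_expand\<close>.\<close>

definition dual_bases :: "'e ab_mod \<Rightarrow> nat \<Rightarrow> (nat \<Rightarrow> 'e) \<Rightarrow> (nat \<Rightarrow> 'e \<Rightarrow> complex fps) \<Rightarrow> bool"
  where "dual_bases E n e p \<longleftrightarrow>
    (\<forall>i<n. e i \<in> carrier E) \<and> (\<forall>i<n. lin_form E (p i)) \<and>
    (\<forall>i<n. \<forall>j<n. p i (e j) = (if i = j then 1 else 0)) \<and>
    (\<forall>x\<in>carrier E. (\<forall>i<n. p i x = 0) \<longrightarrow> x = \<zero>\<^bsub>E\<^esub>)"

lemma dual_basesD:
  assumes "dual_bases E n e p"
  shows "i < n \<Longrightarrow> e i \<in> carrier E" "i < n \<Longrightarrow> lin_form E (p i)"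
    "i < n \<Longrightarrow> j < n \<Longrightarrow> p i (e j) = (if i = j then 1 else 0)"
    "x \<in> carrier E \<Longrightarrow> (\<And>i. i < n \<Longrightarrow> p i x = 0) \<Longrightarrow> x = \<zero>\<^bsub>E\<^esub>"
  using assms by (auto simp: dual_bases_def)

context fps_module
begin

lemma lin_form_zero: "lin_form E f \<Longrightarrow> f \<zero> = 0"
  using lin_form_smult[of E f \<zero> 0] by simp

lemma finsum_lessThan_Suc:
  "g \<in> {..<Suc n} \<rightarrow> carrier E \<Longrightarrow> (\<Oplus>i\<in>{..<Suc n}. g i) = g n \<oplus> (\<Oplus>i\<in>{..<n}. g i)"
  unfolding lessThan_Suc by (rule finsum_insert) auto

lemma lin_form_finsum:
  assumes "lin_form E f" "g \<in> {..<n::nat} \<rightarrow> carrier E"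
  shows "f (\<Oplus>i\<in>{..<n}. g i) = (\<Sum>i<n. f (g i))"
  using assms(2)
proof (induction n)
  case 0 show ?case using lin_form_zero[OF assms(1)] by simp
next
  case (Suc n)
  have "g \<in> {..<n} \<rightarrow> carrier E" "g n \<in> carrier E" using Suc.prems by auto
  with Suc show ?case by (simp add: finsum_lessThan_Suc lin_form_add[OF assms(1)] add.commute)
qed

lemma dual_bases_eqI:
  assumes "dual_bases E n e p" "x \<in> carrier E" "y \<in> carrier E" "\<And>i. i < n \<Longrightarrow> p i x = p i y"
  shows "x = y"
proof -
  have "x \<oplus> (- 1) \<odot> y = \<zero>"
    by (rule dual_basesD(4)[OF assms(1)])
      (use assms in \<open>simp_all add: lin_form_add[OF dual_basesD(2)] lin_form_smult[OF dual_basesD(2)]\<close>)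
  thus ?thesis using assms by (subst eq_iff_diff)
qed

lemma dual_bases_coord:
  assumes "dual_bases E n e p" "j < n"
  shows "p j (\<Oplus>i\<in>{..<n}. c i \<odot> e i) = c j"
proof -
  have "p j (\<Oplus>i\<in>{..<n}. c i \<odot> e i) = (\<Sum>i<n. p j (c i \<odot> e i))"
    by (rule lin_form_finsum) (use assms in \<open>auto simp: dual_bases_def\<close>)
  also have "\<dots> = (\<Sum>i<n. if j = i then c i else 0)"
    by (rule sum.cong)
      (use assms in \<open>auto simp: dual_basesD lin_form_smult[OF dual_basesD(2)[OF assms]]\<close>)
  also have "\<dots> = c j" using assms by simp
  finally show ?thesis .
qed

lemma dual_bases_expand:
  assumes "dual_bases E n e p" "x \<in> carrier E"
  shows "x = (\<Oplus>i\<in>{..<n}. p i x \<odot> e i)"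
  by (rule dual_bases_eqI[OF assms(1)])
    (use assms in \<open>auto simp: dual_basesD(1)[OF assms(1)] dual_bases_coord[OF assms(1)] intro!: finsum_closed\<close>)

lemma free_iff_dual_bases: "free_of_finite_rank E \<longleftrightarrow> (\<exists>n e p. dual_bases E n e p)"
proof
  assume "\<exists>n e p. dual_bases E n e p"
  then obtain n e p where d: "dual_bases E n e p" by blast
  show "free_of_finite_rank E"
    unfolding free_of_finite_rank_def
  proof (rule exI[of _ n], rule exI[of _ e], intro conjI ballI)
    show "e \<in> {..<n} \<rightarrow> carrier E" using d by (auto simp: dual_basesD)
    fix x assume x: "x \<in> carrier E"
    show "\<exists>!c. c \<in> {..<n} \<rightarrow>\<^sub>E UNIV \<and> x = (\<Oplus>i\<in>{..<n}. c i \<odot> e i)"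
    proof (rule ex1I[of _ "\<lambda>i\<in>{..<n}. p i x"])
      have "(\<Oplus>i\<in>{..<n}. (\<lambda>i\<in>{..<n}. p i x) i \<odot> e i) = (\<Oplus>i\<in>{..<n}. p i x \<odot> e i)"
        by (rule finsum_cong') (use d in \<open>auto simp: dual_basesD\<close>)
      thus "(\<lambda>i\<in>{..<n}. p i x) \<in> {..<n} \<rightarrow>\<^sub>E UNIV \<and> x = (\<Oplus>i\<in>{..<n}. (\<lambda>i\<in>{..<n}. p i x) i \<odot> e i)"
        using dual_bases_expand[OF d x] by simp
      fix c assume "c \<in> {..<n} \<rightarrow>\<^sub>E UNIV \<and> x = (\<Oplus>i\<in>{..<n}. c i \<odot> e i)"
      thus "c = (\<lambda>i\<in>{..<n}. p i x)"
        using dual_bases_coord[OF d] by (intro ext) (auto simp: PiE_def extensional_def)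
    qed
  qed
next
  assume "free_of_finite_rank E"
  then obtain n :: nat and e where e: "e \<in> {..<n} \<rightarrow> carrier E"
    and un: "\<And>x. x \<in> carrier E \<Longrightarrow> \<exists>!c. c \<in> {..<n} \<rightarrow>\<^sub>E (UNIV :: complex fps set) \<and>
          x = (\<Oplus>i\<in>{..<n}. c i \<odot> e i)"
    unfolding free_of_finite_rank_def by (elim exE conjE) (rule that, assumption, erule bspec, assumption)
  let ?L = "\<lambda>c. \<Oplus>i\<in>{..<n}. c i \<odot> e i"
  define P where "P = (\<lambda>x. THE c. c \<in> {..<n} \<rightarrow>\<^sub>E (UNIV :: complex fps set) \<and> x = ?L c)"
  have ce: "(\<lambda>i. c i \<odot> e i) \<in> {..<n} \<rightarrow> carrier E" for c using e by auto
  have P: "P x \<in> {..<n} \<rightarrow>\<^sub>E UNIV \<and> x = ?L (P x)" if "x \<in> carrier E" for x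
    unfolding P_def by (rule theI'[OF un[OF that]])
  have LP: "?L (P x) = x" if "x \<in> carrier E" for x
    using P[OF that] by (rule conjunct2[THEN sym])
  have Lc: "?L c \<in> carrier E" for c by (rule finsum_closed[OF ce])
  have PL: "P (?L c) i = c i" if "i < n" for c i
  proof -
    \<comment> \<open>Coordinate families are unique only among extensional ones, so
      \<open>c\<close> is cut down to the index set first.\<close>
    have *: "?L (restrict c {..<n}) = ?L c" by (rule finsum_cong') (use e in auto)
    have "P (?L c) = restrict c {..<n}"
      unfolding P_def by (rule the1_equality[OF un[OF Lc]]) (simp only: *, simp)
    thus ?thesis using that by simp
  qed
  have Ladd: "?L c \<oplus> ?L d = ?L (\<lambda>i. c i + d i)" for c d
  proof -
    have "?L c \<oplus> ?L d = (\<Oplus>i\<in>{..<n}. c i \<odot> e i \<oplus> d i \<odot> e i)"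
      using finsum_addf[OF ce[of c] ce[of d]] by simp
    also have "\<dots> = ?L (\<lambda>i. c i + d i)"
      by (rule finsum_cong') (use e in \<open>auto simp: scale_add Pi_iff\<close>)
    finally show ?thesis .
  qed
  have Lsm: "s \<odot> ?L c = ?L (\<lambda>i. s * c i)" for s c
  proof -
    have "s \<odot> ?L c = (\<Oplus>i\<in>{..<n}. s \<odot> (c i \<odot> e i))"
      using finsum_smult_ldistr[OF _ _ ce[of c], of s] by simp
    also have "\<dots> = ?L (\<lambda>i. s * c i)"
      by (rule finsum_cong') (use e in \<open>auto simp: scale_scale Pi_iff\<close>)
    finally show ?thesis .
  qed
  have "dual_bases E n e (\<lambda>i x. P x i)"
    unfolding dual_bases_def
  proof (intro conjI allI impI ballI)
    fix i assume i: "i < n"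
    thus "e i \<in> carrier E" using e by auto
    show "lin_form E (\<lambda>x. P x i)"
    proof (rule lin_formI)
      fix x y assume x: "x \<in> carrier E" and y: "y \<in> carrier E"
      have "x \<oplus> y = ?L (\<lambda>i. P x i + P y i)"
        using Ladd[of "P x" "P y"] unfolding LP[OF x] LP[OF y] .
      thus "P (x \<oplus> y) i = P x i + P y i" by (simp only: PL[OF i])
    next
      fix s x assume x: "x \<in> carrier E"
      have "s \<odot> x = ?L (\<lambda>i. s * P x i)"
        using Lsm[of s "P x"] unfolding LP[OF x] .
      thus "P (s \<odot> x) i = s * P x i" by (simp only: PL[OF i])
    qed
    fix j assume j: "j < n"
    have "?L (\<lambda>i. if i = j then 1 else 0) = (\<Oplus>i\<in>{..<n}. if j = i then e i else \<zero>)"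
      by (rule finsum_cong') (use e in \<open>auto simp: Pi_iff\<close>)
    also have "\<dots> = e j"
      by (rule finsum_singleton) (use e j in auto)
    finally have "e j = ?L (\<lambda>i. if i = j then 1 else 0)" ..
    thus "P (e j) i = (if i = j then 1 else 0)" by (simp only: PL[OF i])
  next
    fix x assume x: "x \<in> carrier E" and 0: "\<forall>i<n. P x i = 0"
    have "x = ?L (P x)" by (rule LP[OF x, symmetric])
    also have "\<dots> = (\<Oplus>i\<in>{..<n}. \<zero>)" by (rule finsum_cong') (use 0 e in \<open>auto simp: Pi_iff\<close>)
    finally show "x = \<zero>" by simp
  qed
  thus "\<exists>n e p. dual_bases E n e p" by blast
qed

text \<open>
  Over the discrete valuation ring of power series the image of a form is generated by a value of
  minimal order, so that its kernel has a complement generated by one element.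
\<close>

lemma dual_bases_split_off:
  assumes f: "lin_form E f" and "\<exists>x\<in>carrier E. f x \<noteq> 0"
  defines "K \<equiv> {x \<in> carrier E. f x = 0}"
  assumes d: "dual_bases (restrict_carrier E K) m e p"
  shows "\<exists>e' p'. dual_bases E (Suc m) e' p'"
proof -
  define Q where "Q = (\<lambda>x. x \<in> carrier E \<and> f x \<noteq> 0)"
  define x0 where "x0 = (ARG_MIN (\<lambda>x. subdegree (f x)) x. Q x)"
  have ex: "\<exists>x. Q x" using assms(2) by (auto simp: Q_def)
  have Q0: "Q x0" unfolding x0_def using ex arg_min_nat_lemma[of Q] by blast
  have mn: "subdegree (f x0) \<le> subdegree (f x)" if "Q x" for x
    unfolding x0_def using that by (rule arg_min_nat_le)
  have x0[simp]: "x0 \<in> carrier E" and nz: "f x0 \<noteq> 0" using Q0 by (auto simp: Q_def)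
  \<comment> \<open>The division is exact because \<open>x0\<close> has least order. Hence
    \<open>q\<close> is again a form, with the kernel of \<open>f\<close> and the value 1 at
    \<open>x0\<close>.\<close>
  define q where "q = (\<lambda>x. f x div f x0)"
  have q: "f x = q x * f x0" if "x \<in> carrier E" for x
  proof -
    have "f x0 dvd f x"
      using mn[of x] that nz by (cases "f x = 0") (auto simp: fps_dvd_iff Q_def)
    thus ?thesis by (simp add: q_def)
  qed
  have ql: "lin_form E q"
  proof (rule lin_formI)
    fix x y assume xy: "x \<in> carrier E" "y \<in> carrier E"
    hence "q (x \<oplus> y) * f x0 = (q x + q y) * f x0"
      using q[of "x \<oplus> y"] q[of x] q[of y] lin_form_add[OF f, of x y] by (simp add: algebra_simps)
    thus "q (x \<oplus> y) = q x + q y" using nz by simp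
  next
    fix s x assume x: "x \<in> carrier E"
    hence "q (s \<odot> x) * f x0 = (s * q x) * f x0"
      using q[of "s \<odot> x"] q[of x] lin_form_smult[OF f, of x s] by (auto simp: algebra_simps)
    thus "q (s \<odot> x) = s * q x" using nz by simp
  qed
  have q0: "q x0 = 1" using q[of x0] nz by simp
  have "f x = 0 \<longleftrightarrow> q x = 0" if "x \<in> carrier E" for x using q[OF that] nz by simp
  hence K: "K = {x \<in> carrier E. q x = 0}" by (auto simp: K_def)
  have subK: "submodule K fps_ring E"
    by (rule submodule_restrict)
      (auto simp: K lin_form_add[OF ql] lin_form_smult[OF ql] lin_form_zero[OF ql])
  \<comment> \<open>The projection onto \<open>K\<close> along \<open>x0\<close>; the coordinates on
    \<open>K\<close> are extended to E through it, and \<open>q\<close> is the coordinate of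
    \<open>x0\<close>.\<close>
  define R where "R = (\<lambda>x. x \<oplus> (- q x) \<odot> x0)"
  have Rc[simp]: "R x \<in> carrier E" if "x \<in> carrier E" for x using that by (simp add: R_def)
  have RK: "R x \<in> K" if "x \<in> carrier E" for x
    using that by (simp add: K R_def lin_form_add[OF ql] lin_form_smult[OF ql] q0)
  have Radd: "R (x \<oplus> y) = R x \<oplus> R y" if "x \<in> carrier E" "y \<in> carrier E" for x y
  proof -
    have "R x \<oplus> R y = x \<oplus> y \<oplus> ((- q x) \<odot> x0 \<oplus> (- q y) \<odot> x0)"
      using that by (simp add: R_def M.a_ac)
    also have "(- q x) \<odot> x0 \<oplus> (- q y) \<odot> x0 = (- q (x \<oplus> y)) \<odot> x0"
      using that by (simp add: scale_add[symmetric] lin_form_add[OF ql])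
    finally show ?thesis by (simp add: R_def)
  qed
  have Rsm: "R (s \<odot> x) = s \<odot> R x" if "x \<in> carrier E" for s x
    using that by (simp add: R_def scale_add_right scale_scale lin_form_smult[OF ql])
  have R_id: "R x = x" if "x \<in> K" for x using that by (simp add: R_def K)
  have R0: "R x0 = \<zero>" using eq_iff_diff[of x0 x0] by (simp add: R_def q0)
  have modK: "fps_module (restrict_carrier E K)" by (rule fps_module_restrict[OF subK])
  have KE: "x \<in> K \<Longrightarrow> x \<in> carrier E" for x by (simp add: K)
  interpret K: fps_module "restrict_carrier E K" by (rule modK)
  have eK: "i < m \<Longrightarrow> e i \<in> K" for i using dual_basesD(1)[OF d] by simp
  have pl: "lin_form (restrict_carrier E K) (p i)" if "i < m" for i by (rule dual_basesD(2)[OF d that])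
  define e' where "e' = e(m := x0)"
  define p' where "p' = (\<lambda>i x. if i < m then p i (R x) else q x)"
  have "dual_bases E (Suc m) e' p'"
    unfolding dual_bases_def
  proof (intro conjI allI impI ballI)
    fix i assume i: "i < Suc m"
    show "e' i \<in> carrier E" using i eK KE by (auto simp: e'_def less_Suc_eq)
    show "lin_form E (p' i)"
    proof (cases "i < m")
      case True
      show ?thesis
      proof (rule lin_formI)
        fix x y assume xy: "x \<in> carrier E" "y \<in> carrier E"
        show "p' i (x \<oplus> y) = p' i x + p' i y"
          using True lin_form_add[OF pl[OF True], of "R x" "R y"] xy by (simp add: p'_def Radd RK)
      next
        fix s x assume x: "x \<in> carrier E"
        show "p' i (s \<odot> x) = s * p' i x"
          using True lin_form_smult[OF pl[OF True], of "R x" s] x by (simp add: p'_def Rsm RK)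
      qed
    next
      case False
      thus ?thesis using ql i by (simp add: p'_def lin_form_def)
    qed
    fix j assume j: "j < Suc m"
    have p0: "i < m \<Longrightarrow> p i \<zero> = 0" using K.lin_form_zero[OF pl[of i]] by simp
    show "p' i (e' j) = (if i = j then 1 else 0)"
      using i j p0 dual_basesD(3)[OF d, of i j] eK[of j]
      by (auto simp: p'_def e'_def less_Suc_eq R_id R0 q0) (auto simp: K)
  next
    fix x assume x: "x \<in> carrier E" and z: "\<forall>i<Suc m. p' i x = 0"
    have "q x = 0" using z[rule_format, of m] by (simp add: p'_def)
    hence xK: "x \<in> K" using x by (simp add: K)
    have "p i x = 0" if "i < m" for i using z[rule_format, of i] that R_id[OF xK] by (simp add: p'_def)
    thus "x = \<zero>" using dual_basesD(4)[OF d, of x] xK by simp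
  qed
  thus ?thesis by blast
qed

end

text \<open>The fact that submodules of free modules over a discrete valuation ring are free,
  phrased by forms so that no ambient module is needed. On the kernel of the last form the remaining
  ones still separate points, and the kernel has a complement of rank at most one.\<close>

lemma dual_bases_exist:
  fixes E :: "'e ab_mod" and n :: nat
  assumes "fps_module E" "\<And>i. i < n \<Longrightarrow> lin_form E (f i)"
    and "\<And>x. x \<in> carrier E \<Longrightarrow> (\<And>i. i < n \<Longrightarrow> f i x = 0) \<Longrightarrow> x = \<zero>\<^bsub>E\<^esub>"
  shows "\<exists>m e p. dual_bases E m e p"
  using assms
proof (induction n arbitrary: E)
  case 0
  hence "dual_bases E 0 e p" for e p by (auto simp: dual_bases_def)
  thus ?case by blast
next
  case (Suc n)
  interpret fps_module E by fact
  note fn = Suc.prems(2)[of n, simplified]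
  define K where "K = {x \<in> carrier E. f n x = 0}"
  have "submodule K fps_ring E"
    by (rule submodule_restrict)
      (auto simp: K_def lin_form_add[OF fn] lin_form_smult[OF fn] lin_form_zero[OF fn])
  note modK = fps_module_restrict[OF this]
  obtain m e p where d: "dual_bases (restrict_carrier E K) m e p"
  proof (atomize_elim, rule Suc.IH[OF modK])
    fix i assume "i < n"
    thus "lin_form (restrict_carrier E K) (f i)"
      using Suc.prems(2)[of i] by (auto simp: lin_form_def K_def)
  next
    fix x assume "x \<in> carrier (restrict_carrier E K)" "\<And>i. i < n \<Longrightarrow> f i x = 0"
    thus "x = \<zero>\<^bsub>restrict_carrier E K\<^esub>"
      using Suc.prems(3)[of x] by (auto simp: K_def less_Suc_eq)
  qed
  show ?case
  proof (cases "\<exists>x\<in>carrier E. f n x \<noteq> 0")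
    case True
    show ?thesis using dual_bases_split_off[OF fn True] d unfolding K_def by blast
  next
    case False
    hence "K = carrier E" by (auto simp: K_def)
    thus ?thesis using d by auto
  qed
qed

text \<open>The coordinate forms of \<open>G\<close>, pulled back along \<open>f\<close>, have only
  0 as a common zero.\<close>

lemma free_of_injective:
  assumes "fps_module E" "fps_module G" "free_of_finite_rank G" "f \<in> lin_hom E G" "inj_on f (carrier E)"
  shows "free_of_finite_rank E"
proof -
  interpret E: fps_module E by fact
  interpret G: fps_module G by fact
  obtain n e p where d: "dual_bases G n e p" using assms(3) G.free_iff_dual_bases by blast
  have f: "f x \<in> carrier G" if "x \<in> carrier E" for x using assms(4) that by (auto simp: lin_hom_def)
  have f0: "f \<zero>\<^bsub>E\<^esub> = \<zero>\<^bsub>G\<^esub>"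
    using assms(4) G.scale_zero[OF f[of "\<zero>\<^bsub>E\<^esub>"]] E.scale_zero_right[of 0] E.M.zero_closed
    unfolding lin_hom_def by force
  have "\<exists>m e p. dual_bases E m e p"
  proof (rule dual_bases_exist[OF assms(1), of n "\<lambda>i x. p i (f x)"])
    show "lin_form E (\<lambda>x. p i (f x))" if "i < n" for i
      using lin_form_comp[OF assms(4) dual_basesD(2)[OF d that]] .
    fix x assume x: "x \<in> carrier E" and "\<And>i. i < n \<Longrightarrow> p i (f x) = 0"
    hence "f x = \<zero>\<^bsub>G\<^esub>" using dual_basesD(4)[OF d f] by blast
    thus "x = \<zero>\<^bsub>E\<^esub>" using f0 assms(5) x by (auto dest!: inj_onD[of f _ x "\<zero>\<^bsub>E\<^esub>"])
  qed
  thus ?thesis using E.free_iff_dual_bases by blast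
qed

section \<open>(a,b)-modules, conjugates and duals\<close>

lemma fps_eq_0_of_X_power_dvd:
  assumes "\<And>N. fps_X ^ N dvd (f :: complex fps)"
  shows "f = 0"
proof (rule fps_ext)
  fix n
  obtain g where "f = fps_X ^ Suc n * g" using assms[of "Suc n"] by (auto simp: dvd_def)
  thus "f $ n = 0 $ n" by (simp add: fps_X_power_mult_nth del: power_Suc)
qed

sublocale ab_module \<subseteq> fps_module
  by unfold_locales

context ab_module
begin

text \<open>Coordinates are forms. With this, an equation between module elements becomes one
  between power series, which ring simplification can settle.\<close>

lemma form_eqI:
  assumes "x \<in> carrier E" "y \<in> carrier E" "\<And>p. lin_form E p \<Longrightarrow> p x = p y"
  shows "x = y"
  using free assms unfolding free_iff_dual_bases by (metis dual_bases_eqI dual_basesD(2))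

lemma scale_cancel:
  assumes "s \<noteq> 0" "x \<in> carrier E" "y \<in> carrier E" "s \<odot> x = s \<odot> y"
  shows "x = y"
proof (rule form_eqI)
  fix p assume "lin_form E p"
  thus "p x = p y" using arg_cong[OF assms(4), of p] assms(1-3) by (simp add: lin_form_smult)
qed (use assms in auto)

lemma X_power_cancel:
  assumes "x \<in> carrier E" "y \<in> carrier E" "fps_X ^ n \<odot> x = fps_X ^ n \<odot> y"
  shows "x = y"
  by (rule scale_cancel[OF _ assms]) simp

lemma a_X:
  assumes "x \<in> carrier E"
  shows "a_op E (fps_X \<odot> x) = fps_X \<odot> a_op E x \<oplus> fps_X ^ 2 \<odot> x"
  using a_b_commutator[OF assms] assms
  by (simp add: b_op_def minus_eq_iff a_closed scale_scale power2_eq_square)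

text \<open>The axioms give the rule for constants and for b, hence for polynomials; passing to
  power series needs a limit argument without any assumed continuity of a. The defect
  \<open>D s\<close> equals b times the defect of the shifted series, so every power of b divides
  it. Applying a form first places the defect in C[[b]], where this forces it to vanish.\<close>

lemma form_a_scale:
  assumes p: "lin_form E p" and x: "x \<in> carrier E"
  shows "p (a_op E (s \<odot> x)) = s * p (a_op E x) + fps_X ^ 2 * fps_deriv s * p x"
proof -
  define D where "D s = p (a_op E (s \<odot> x)) - s * p (a_op E x) - fps_X ^ 2 * fps_deriv s * p x" for s
  have step: "D s = fps_X * D (fps_shift 1 s)" for s
  proof -
    define c r where "c = fps_const (s $ 0)" and "r = fps_shift 1 s"
    have s: "s = c + fps_X * r"
      by (rule fps_ext) (auto simp: c_def r_def)
    have "s \<odot> x = c \<odot> x \<oplus> fps_X \<odot> (r \<odot> x)" using x by (simp add: s scale_add scale_scale)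
    hence "a_op E (s \<odot> x) = c \<odot> a_op E x \<oplus> (fps_X \<odot> a_op E (r \<odot> x) \<oplus> fps_X ^ 2 \<odot> (r \<odot> x))"
      using x by (simp add: a_add a_X) (simp add: c_def a_scale)
    hence "p (a_op E (s \<odot> x)) = c * p (a_op E x) + (fps_X * p (a_op E (r \<odot> x)) + fps_X ^ 2 * (r * p x))"
      using x p by (simp add: lin_form_add lin_form_smult a_closed)
    thus ?thesis
      unfolding D_def r_def[symmetric]
      by (simp add: s) (simp add: c_def algebra_simps power2_eq_square)
  qed
  have "fps_X ^ N dvd D s" for N s
  proof (induction N arbitrary: s)
    case (Suc N)
    thus ?case using step[of s] by (simp add: mult_dvd_mono)
  qed simp
  hence "D s = 0" by (rule fps_eq_0_of_X_power_dvd)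
  thus ?thesis by (simp add: D_def algebra_simps)
qed

lemma a_leibniz:
  assumes "x \<in> carrier E"
  shows "a_op E (s \<odot> x) = s \<odot> a_op E x \<oplus> (fps_X ^ 2 * fps_deriv s) \<odot> x"
  by (rule form_eqI)
    (use assms in \<open>simp_all add: a_closed lin_form_add lin_form_smult form_a_scale\<close>)

end

text \<open>The Leibniz rule contains two axioms at once: a constant \<open>s\<close> gives
  C-linearity, and s = b gives the commutator relation.\<close>

lemma ab_moduleI:
  fixes E :: "'e ab_mod" (structure)
  assumes "fps_module E" "free_of_finite_rank E"
    and a_closed: "\<And>x. x \<in> carrier E \<Longrightarrow> a_op E x \<in> carrier E"
    and "\<And>x y. x \<in> carrier E \<Longrightarrow> y \<in> carrier E \<Longrightarrow> a_op E (x \<oplus> y) = a_op E x \<oplus> a_op E y"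
    and lb: "\<And>s x. x \<in> carrier E \<Longrightarrow> a_op E (s \<odot> x) = s \<odot> a_op E x \<oplus> (fps_X ^ 2 * fps_deriv s) \<odot> x"
  shows "ab_module E"
proof -
  interpret fps_module E by fact
  show ?thesis
    by unfold_locales
      (use assms in \<open>simp_all add: lb b_op_def minus_eq_iff scale_scale power2_eq_square\<close>)
qed

section \<open>Conjugate modules, duals and submodules\<close>

lemma ab_check_simps [simp]:
  "carrier (ab_check E) = carrier E" "add (ab_check E) = add E" "zero (ab_check E) = zero E"
  "s \<odot>\<^bsub>ab_check E\<^esub> x = conj_fps s \<odot>\<^bsub>E\<^esub> x" "a_op (ab_check E) x = \<ominus>\<^bsub>E\<^esub> a_op E x"
  by (simp_all add: ab_check_def conj_fps_def)

text \<open>In the Leibniz rule the sign of -a cancels the sign from differentiating s(-b), while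
  b^2 is fixed by conjugation. The basis stays the same and its coordinates are conjugated.\<close>

lemma ab_module_ab_check:
  assumes "ab_module E"
  shows "ab_module (ab_check E)"
proof -
  interpret ab_module E by fact
  have m: "fps_module (ab_check E)"
    by (rule fps_moduleI) (simp_all add: M.a_ac scale_add scale_add_right scale_scale)
  interpret C: fps_module "ab_check E" by fact
  obtain n e p where d: "dual_bases E n e p" using free free_iff_dual_bases by blast
  have "dual_bases (ab_check E) n e (\<lambda>i x. conj_fps (p i x))"
    unfolding dual_bases_def
  proof (intro conjI allI impI ballI)
    fix x assume "x \<in> carrier (ab_check E)" "\<forall>i<n. conj_fps (p i x) = 0"
    hence "x \<in> carrier E" "\<And>i. i < n \<Longrightarrow> p i x = 0" by (auto) (metis conj_fps_simps(6,10))
    thus "x = \<zero>\<^bsub>ab_check E\<^esub>" using dual_basesD(4)[OF d] by simp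
  qed (use dual_basesD[OF d] in \<open>auto simp: lin_form_def\<close>)
  hence f: "free_of_finite_rank (ab_check E)" using C.free_iff_dual_bases by blast
  show ?thesis
    by (rule ab_moduleI[OF m f])
      (simp_all add: neg_eq a_add a_closed a_leibniz scale_add_right scale_scale fps_deriv_conj_fps M.a_ac)
qed

lemma ab_rank1_a_op: "a_op (ab_rank1 d) s = fps_const d * fps_X * s + fps_X ^ 2 * fps_deriv s"
  by (simp add: ab_rank1_def)

lemma ab_rank1_a_op_simps:
  "a_op (ab_rank1 d) (s + t) = a_op (ab_rank1 d) s + a_op (ab_rank1 d) t"
  "a_op (ab_rank1 d) (s * t) = s * a_op (ab_rank1 d) t + fps_X ^ 2 * fps_deriv s * t"
  by (simp_all add: ab_rank1_a_op algebra_simps)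

lemma ab_Hom_simps [simp]:
  "\<phi> \<in> carrier (ab_Hom E (ab_rank1 d)) \<longleftrightarrow> lin_form E \<phi> \<and> \<phi> \<in> extensional (carrier E)"
  "\<phi> \<oplus>\<^bsub>ab_Hom E (ab_rank1 d)\<^esub> \<psi> = (\<lambda>x\<in>carrier E. \<phi> x + \<psi> x)"
  "\<zero>\<^bsub>ab_Hom E (ab_rank1 d)\<^esub> = (\<lambda>x\<in>carrier E. 0)"
  "s \<odot>\<^bsub>ab_Hom E (ab_rank1 d)\<^esub> \<phi> = (\<lambda>x\<in>carrier E. s * \<phi> x)"
  "a_op (ab_Hom E (ab_rank1 d)) \<phi> = (\<lambda>x\<in>carrier E. a_op (ab_rank1 d) (\<phi> x) - \<phi> (a_op E x))"
  by (auto simp: ab_Hom_def lin_hom_ab_rank1 minus_ab_rank1)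

text \<open>The coordinate forms of E are a basis of the dual, and evaluations at the basis of E are
  their coordinates.\<close>

lemma ab_module_ab_Hom:
  assumes "ab_module E"
  shows "ab_module (ab_Hom E (ab_rank1 d))"
proof -
  interpret ab_module E by fact
  let ?H = "ab_Hom E (ab_rank1 d)"
  have m: "fps_module ?H"
    by (rule fps_moduleI)
      (auto simp: lin_form_def algebra_simps extensional_def fun_eq_iff)
  interpret H: fps_module ?H by fact
  obtain n e p where b: "dual_bases E n e p" using free free_iff_dual_bases by blast
  note bD = dual_basesD[OF b]
  have "dual_bases ?H n (\<lambda>i. restrict (p i) (carrier E)) (\<lambda>i \<phi>. \<phi> (e i))"
    unfolding dual_bases_def
  proof (intro conjI allI impI ballI)
    fix i assume i: "i < n"
    show "restrict (p i) (carrier E) \<in> carrier ?H"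
      using bD(2)[OF i] by (auto simp: lin_form_def)
    show "lin_form ?H (\<lambda>\<phi>. \<phi> (e i))" using bD(1)[OF i] by (auto simp: lin_form_def)
    fix j assume "j < n"
    thus "restrict (p j) (carrier E) (e i) = (if i = j then 1 else 0)"
      using bD(1,3) i by auto
  next
    fix \<phi> assume f: "\<phi> \<in> carrier ?H" and 0: "\<forall>i<n. \<phi> (e i) = 0"
    have fl: "lin_form E \<phi>" and fe: "\<phi> \<in> extensional (carrier E)" using f by auto
    have "\<phi> x = 0" if "x \<in> carrier E" for x
    proof -
      have "\<phi> x = \<phi> (\<Oplus>\<^bsub>E\<^esub>i\<in>{..<n}. p i x \<odot>\<^bsub>E\<^esub> e i)" using dual_bases_expand[OF b that] by simp
      also have "\<dots> = (\<Sum>i<n. \<phi> (p i x \<odot>\<^bsub>E\<^esub> e i))" by (rule lin_form_finsum[OF fl]) (use bD in auto)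
      also have "\<dots> = 0" by (rule sum.neutral) (use 0 bD lin_form_smult[OF fl] in auto)
      finally show ?thesis .
    qed
    thus "\<phi> = \<zero>\<^bsub>?H\<^esub>" using fe by (auto simp: extensional_def fun_eq_iff)
  qed
  hence f: "free_of_finite_rank ?H" using H.free_iff_dual_bases by blast
  show ?thesis
  proof (rule ab_moduleI[OF m f])
    fix \<phi> assume "\<phi> \<in> carrier ?H"
    hence fl: "lin_form E \<phi>" by simp
    \<comment> \<open>Neither term is linear over C[[b]] by itself; their two contributions b^2 s'
      \<phi>(x) cancel.\<close>
    have "lin_form E (\<lambda>x. a_op (ab_rank1 d) (\<phi> x) - \<phi> (a_op E x))"
      by (rule lin_formI)
        (use fl in \<open>simp_all add: lin_form_add lin_form_smult a_add a_leibniz a_closed ab_rank1_a_op_simps algebra_simps\<close>)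
    thus "a_op ?H \<phi> \<in> carrier ?H" by (simp add: lin_form_def)
  qed (auto simp: fun_eq_iff a_closed ab_rank1_a_op_simps algebra_simps)
qed

lemma ab_module_restrict_carrier:
  assumes "ab_module E" "sub_ab_module F E"
  shows "ab_module (restrict_carrier E F)"
proof -
  interpret ab_module E by fact
  have F: "submodule F fps_ring E" "\<And>x. x \<in> F \<Longrightarrow> a_op E x \<in> F"
    using assms(2) by (auto simp: sub_ab_module_def)
  note FE = submoduleE(1)[OF F(1)]
  have m: "fps_module (restrict_carrier E F)" by (rule fps_module_restrict[OF F(1)])
  have f: "free_of_finite_rank (restrict_carrier E F)"
    by (rule free_of_injective[OF m _ free, of id]) (use FE in \<open>auto simp: lin_hom_def fps_module_axioms\<close>)
  show ?thesis
    by (rule ab_moduleI[OF m f]) (use FE F(2) in \<open>auto simp: a_add a_leibniz subset_iff\<close>)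
qed

text \<open>The pairing form of an isomorphism from the conjugate of \<open>M\<close> to the dual of
  \<open>N\<close>. Two modules are allowed because the pairs (E, E), (F, saturation) and
  (saturation, F) all occur. Values outside the carriers are left free, so that pairings can be
  composed without restrictions; \<open>iso\<close> restores extensionality.\<close>

locale ab_duality = M: ab_module M + N: ab_module N
  for M :: "'m ab_mod" and N :: "'n ab_mod" and \<delta> :: complex and \<kappa> :: "'m \<Rightarrow> 'n \<Rightarrow> complex fps" +
  assumes form: "m \<in> carrier M \<Longrightarrow> lin_form N (\<kappa> m)"
    and add: "m \<in> carrier M \<Longrightarrow> m' \<in> carrier M \<Longrightarrow> n \<in> carrier N \<Longrightarrow>
      \<kappa> (m \<oplus>\<^bsub>M\<^esub> m') n = \<kappa> m n + \<kappa> m' n"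
    and smult: "m \<in> carrier M \<Longrightarrow> n \<in> carrier N \<Longrightarrow> \<kappa> (s \<odot>\<^bsub>M\<^esub> m) n = conj_fps s * \<kappa> m n"
    and a: "m \<in> carrier M \<Longrightarrow> n \<in> carrier N \<Longrightarrow>
      a_op (ab_rank1 \<delta>) (\<kappa> m n) = \<kappa> m (a_op N n) - \<kappa> (a_op M m) n"
    and inj: "m \<in> carrier M \<Longrightarrow> m' \<in> carrier M \<Longrightarrow>
      (\<And>n. n \<in> carrier N \<Longrightarrow> \<kappa> m n = \<kappa> m' n) \<Longrightarrow> m = m'"
    and surj: "lin_form N \<psi> \<Longrightarrow> \<exists>m\<in>carrier M. \<forall>n\<in>carrier N. \<kappa> m n = \<psi> n"
begin

lemma form_add: "m \<in> carrier M \<Longrightarrow> n \<in> carrier N \<Longrightarrow> n' \<in> carrier N \<Longrightarrow>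
    \<kappa> m (n \<oplus>\<^bsub>N\<^esub> n') = \<kappa> m n + \<kappa> m n'"
  and form_smult: "m \<in> carrier M \<Longrightarrow> n \<in> carrier N \<Longrightarrow> \<kappa> m (s \<odot>\<^bsub>N\<^esub> n) = s * \<kappa> m n"
  using form by (auto simp: lin_form_def)

lemma iso: "ab_iso (ab_check M) (ab_Hom N (ab_rank1 \<delta>)) (\<lambda>m. restrict (\<kappa> m) (carrier N))"
proof -
  let ?k = "\<lambda>m. restrict (\<kappa> m) (carrier N)"
  have neg: "\<kappa> (\<ominus>\<^bsub>M\<^esub> a_op M m) n = - \<kappa> (a_op M m) n" if "m \<in> carrier M" "n \<in> carrier N" for m n
    using that by (simp add: M.neg_eq M.a_closed smult)
  have car: "?k m \<in> carrier (ab_Hom N (ab_rank1 \<delta>))" if "m \<in> carrier M" for m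
    using form[OF that] by (auto simp: lin_form_def)
  have "?k \<in> ab_hom (ab_check M) (ab_Hom N (ab_rank1 \<delta>))"
    unfolding ab_hom_def lin_hom_def using car
    by (auto simp: restrict_def fun_eq_iff add smult neg a N.a_closed)
  moreover have "bij_betw ?k (carrier M) (carrier (ab_Hom N (ab_rank1 \<delta>)))"
  proof (rule bij_betw_imageI)
    show "inj_on ?k (carrier M)"
      by (rule inj_onI, rule inj) (auto simp: restrict_def fun_eq_iff, metis)
    show "?k ` carrier M = carrier (ab_Hom N (ab_rank1 \<delta>))"
    proof (intro equalityI subsetI)
      fix \<psi> assume "\<psi> \<in> carrier (ab_Hom N (ab_rank1 \<delta>))"
      moreover from this obtain m where m: "m \<in> carrier M" "\<forall>n\<in>carrier N. \<kappa> m n = \<psi> n"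
        using surj[of \<psi>] by auto
      ultimately have "\<psi> = ?k m" by (auto simp: extensional_def fun_eq_iff)
      thus "\<psi> \<in> ?k ` carrier M" using m by blast
    qed (use car in auto)
  qed
  ultimately show ?thesis
    using ab_module_ab_check[OF M.ab_module_axioms] ab_module_ab_Hom[OF N.ab_module_axioms]
    by (simp add: ab_iso_def)
qed

text \<open>
  Dual to a basis \<open>e\<^sub>i\<close> of \<open>N\<close>, with coordinates \<open>p\<^sub>i\<close>, there are \<open>m\<^sub>i\<close> in \<open>M\<close> with
  \<open>\<kappa> m\<^sub>i = p\<^sub>i\<close>; then the \<open>n\<close> representing a form \<open>\<psi>\<close> on \<open>M\<close> has coordinates \<open>\<psi> m\<^sub>i\<close>, up to conjugation.
\<close>

lemma transpose: "ab_duality N M \<delta> (\<lambda>n m. conj_fps (\<kappa> m n))"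
proof -
  obtain r e p where b: "dual_bases N r e p" using N.free N.free_iff_dual_bases by blast
  note bD = dual_basesD[OF b]
  have "\<forall>i. \<exists>m. i < r \<longrightarrow> m \<in> carrier M \<and> (\<forall>n\<in>carrier N. \<kappa> m n = p i n)"
    using surj bD(2) by metis
  then obtain f where f: "\<And>i. i < r \<Longrightarrow> f i \<in> carrier M"
    and kf: "\<And>i n. i < r \<Longrightarrow> n \<in> carrier N \<Longrightarrow> \<kappa> (f i) n = p i n" by metis
  have cl: "lin_form M (\<lambda>m. conj_fps (\<kappa> m n))" if "n \<in> carrier N" for n
    by (rule lin_formI) (use that in \<open>simp_all add: add smult\<close>)
  \<comment> \<open>The \<open>f i\<close> are dual to the \<open>e i\<close>, so \<open>m\<close>
    is the combination of the \<open>f i\<close> with coefficients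
    \<open>conj_fps (\<kappa> m (e i))\<close>; apply \<psi> to it.\<close>
  have lin_eq: "\<psi> m = (\<Sum>i<r. conj_fps (\<kappa> m (e i)) * \<psi> (f i))"
    if \<psi>: "lin_form M \<psi>" and m: "m \<in> carrier M" for \<psi> m
  proof -
    let ?m = "\<Oplus>\<^bsub>M\<^esub>i\<in>{..<r}. conj_fps (\<kappa> m (e i)) \<odot>\<^bsub>M\<^esub> f i"
    have car: "(\<lambda>i. conj_fps (\<kappa> m (e i)) \<odot>\<^bsub>M\<^esub> f i) \<in> {..<r} \<rightarrow> carrier M" using f by auto
    have mc: "?m \<in> carrier M" by (rule M.finsum_closed[OF car])
    have "?m = m"
    proof (rule inj[OF mc m])
      fix n assume n: "n \<in> carrier N"
      \<comment> \<open>Conjugating makes the pairing linear in its first argument, so that it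
        commutes with the sum.\<close>
      have "conj_fps (\<kappa> ?m n) = (\<Sum>i<r. conj_fps (\<kappa> (conj_fps (\<kappa> m (e i)) \<odot>\<^bsub>M\<^esub> f i) n))"
        by (rule M.lin_form_finsum[OF cl[OF n] car])
      also have "\<dots> = (\<Sum>i<r. conj_fps (\<kappa> m (p i n \<odot>\<^bsub>N\<^esub> e i)))"
        by (rule sum.cong) (use n m f kf bD(1) in \<open>auto simp: smult form_smult mult.commute\<close>)
      also have "\<dots> = conj_fps (\<Sum>i<r. \<kappa> m (p i n \<odot>\<^bsub>N\<^esub> e i))"
        by (induction r) simp_all
      also have "(\<Sum>i<r. \<kappa> m (p i n \<odot>\<^bsub>N\<^esub> e i)) = \<kappa> m (\<Oplus>\<^bsub>N\<^esub>i\<in>{..<r}. p i n \<odot>\<^bsub>N\<^esub> e i)"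
        by (rule N.lin_form_finsum[OF form[OF m], symmetric]) (use bD(1) in auto)
      also have "\<dots> = \<kappa> m n" using N.dual_bases_expand[OF b n] by simp
      finally show "\<kappa> ?m n = \<kappa> m n" by (metis conj_fps_simps(10))
    qed
    hence "\<psi> m = \<psi> ?m" by simp
    also have "\<dots> = (\<Sum>i<r. \<psi> (conj_fps (\<kappa> m (e i)) \<odot>\<^bsub>M\<^esub> f i))"
      by (rule M.lin_form_finsum[OF \<psi> car])
    also have "\<dots> = (\<Sum>i<r. conj_fps (\<kappa> m (e i)) * \<psi> (f i))"
      by (rule sum.cong) (use f \<psi> in \<open>auto simp: lin_form_smult\<close>)
    finally show ?thesis .
  qed
  \<comment> \<open>This sign swaps the two terms of the rule \<open>a\<close>, which is exactly the
    rule required after exchanging the arguments, with \<delta> unchanged.\<close>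
  have conj_a: "conj_fps (a_op (ab_rank1 \<delta>) s) = - a_op (ab_rank1 \<delta>) (conj_fps s)" for s
    by (simp add: ab_rank1_a_op fps_deriv_conj_fps)
  show ?thesis
  proof (intro_locales, unfold_locales)
    fix n m assume "n \<in> carrier N" "m \<in> carrier M"
    thus "a_op (ab_rank1 \<delta>) (conj_fps (\<kappa> m n)) = conj_fps (\<kappa> (a_op M m) n) - conj_fps (\<kappa> m (a_op N n))"
      using arg_cong[OF a[of m n], of conj_fps] by (simp add: conj_a algebra_simps)
  next
    fix n n' assume n: "n \<in> carrier N" "n' \<in> carrier N"
      and eq: "\<And>m. m \<in> carrier M \<Longrightarrow> conj_fps (\<kappa> m n) = conj_fps (\<kappa> m n')"
    have "\<kappa> m n = \<kappa> m n'" if "m \<in> carrier M" for m using eq[OF that] by (metis conj_fps_simps(10))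
    hence "p i n = p i n'" if "i < r" for i using kf[OF that] n f[OF that] by metis
    thus "n = n'" using N.dual_bases_eqI[OF b] n by blast
  next
    fix \<psi> assume \<psi>: "lin_form M \<psi>"
    let ?g = "\<lambda>i. conj_fps (\<psi> (f i)) \<odot>\<^bsub>N\<^esub> e i"
    have g: "?g \<in> {..<r} \<rightarrow> carrier N" using bD(1) by auto
    have "conj_fps (\<kappa> m (\<Oplus>\<^bsub>N\<^esub>i\<in>{..<r}. ?g i)) = \<psi> m" if m: "m \<in> carrier M" for m
    proof -
      have "\<kappa> m (\<Oplus>\<^bsub>N\<^esub>i\<in>{..<r}. ?g i) = (\<Sum>i<r. \<kappa> m (?g i))"
        by (rule N.lin_form_finsum[OF form[OF m] g])
      also have "\<dots> = (\<Sum>i<r. conj_fps (conj_fps (\<kappa> m (e i)) * \<psi> (f i)))"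
        by (rule sum.cong) (use bD(1) m in \<open>auto simp: form_smult mult.commute\<close>)
      also have "\<dots> = conj_fps (\<Sum>i<r. conj_fps (\<kappa> m (e i)) * \<psi> (f i))"
        by (induction r) simp_all
      finally show ?thesis using lin_eq[OF \<psi> m] by simp
    qed
    thus "\<exists>n\<in>carrier N. \<forall>m\<in>carrier M. conj_fps (\<kappa> m n) = \<psi> m"
      using N.finsum_closed[OF g] by blast
  qed (use cl in \<open>auto simp: form_add form_smult\<close>)
qed

end

lemma ab_duality_of_iso:
  assumes "ab_module M" "ab_module N" and iso: "ab_iso (ab_check M) (ab_Hom N (ab_rank1 \<delta>)) \<kappa>"
  shows "ab_duality M N \<delta> \<kappa>"
proof -
  interpret M: ab_module M by fact
  interpret N: ab_module N by fact
  have hom: "\<kappa> \<in> ab_hom (ab_check M) (ab_Hom N (ab_rank1 \<delta>))"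
    and bij: "bij_betw \<kappa> (carrier M) (carrier (ab_Hom N (ab_rank1 \<delta>)))"
    using iso by (auto simp: ab_iso_def)
  have form: "lin_form N (\<kappa> m)" "\<kappa> m \<in> extensional (carrier N)" if "m \<in> carrier M" for m
    using bij_betwE[OF bij] that by auto
  have add: "\<kappa> (m \<oplus>\<^bsub>M\<^esub> m') n = \<kappa> m n + \<kappa> m' n"
    if "m \<in> carrier M" "m' \<in> carrier M" "n \<in> carrier N" for m m' n
    using hom that by (auto simp: ab_hom_def lin_hom_def)
  have smult: "\<kappa> (s \<odot>\<^bsub>M\<^esub> m) n = conj_fps s * \<kappa> m n" if "m \<in> carrier M" "n \<in> carrier N" for s m n
  proof -
    \<comment> \<open>On the conjugate module a scalar acts through its conjugate, so linearity is
      taken at \<open>conj_fps s\<close>.\<close>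
    have "\<kappa> (conj_fps (conj_fps s) \<odot>\<^bsub>M\<^esub> m) = (\<lambda>n\<in>carrier N. conj_fps s * \<kappa> m n)"
      using hom that(1) unfolding ab_hom_def lin_hom_def by (simp del: conj_fps_simps)
    thus ?thesis using that by simp
  qed
  have a: "a_op (ab_rank1 \<delta>) (\<kappa> m n) = \<kappa> m (a_op N n) - \<kappa> (a_op M m) n"
    if "m \<in> carrier M" "n \<in> carrier N" for m n
  proof -
    have "\<kappa> (\<ominus>\<^bsub>M\<^esub> a_op M m) = (\<lambda>n\<in>carrier N. a_op (ab_rank1 \<delta>) (\<kappa> m n) - \<kappa> m (a_op N n))"
      using hom that(1) by (auto simp: ab_hom_def)
    hence "\<kappa> (\<ominus>\<^bsub>M\<^esub> a_op M m) n = a_op (ab_rank1 \<delta>) (\<kappa> m n) - \<kappa> m (a_op N n)"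
      using that by simp
    moreover have "\<kappa> (\<ominus>\<^bsub>M\<^esub> a_op M m) n = - \<kappa> (a_op M m) n"
      using that by (simp add: M.neg_eq M.a_closed smult)
    ultimately show ?thesis by (simp add: algebra_simps)
  qed
  show ?thesis
  proof (intro_locales, unfold_locales)
    fix m m' assume m: "m \<in> carrier M" "m' \<in> carrier M"
      and eq: "\<And>n. n \<in> carrier N \<Longrightarrow> \<kappa> m n = \<kappa> m' n"
    have "\<kappa> m = \<kappa> m'" by (rule extensionalityI[OF form(2) form(2)]) (use m eq in auto)
    thus "m = m'" using bij m by (auto simp: bij_betw_def inj_on_def)
  next
    fix \<psi> assume "lin_form N \<psi>"
    hence "restrict \<psi> (carrier N) \<in> carrier (ab_Hom N (ab_rank1 \<delta>))" by (auto simp: lin_form_def)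
    then obtain m where "m \<in> carrier M" "\<kappa> m = restrict \<psi> (carrier N)"
      using bij unfolding bij_betw_def by (metis imageE)
    thus "\<exists>m\<in>carrier M. \<forall>n\<in>carrier N. \<kappa> m n = \<psi> n" by (intro bexI[of _ m]) simp_all
  qed (use form add smult a in auto)
qed

section \<open>Localization and saturation\<close>

definition b_inverse_a :: "'e ab_mod \<Rightarrow> ('e \<times> nat) set \<Rightarrow> ('e \<times> nat) set"
  where "b_inverse_a E u = loc_b_inverse E (a_op (ab_loc E) u)"

text \<open>An inductive form of the carrier of \<open>saturation\<close> (see
  \<open>carrier_saturation\<close>), which makes induction over the saturation available. Closure
  under C[[b]] is not built in but follows from the Leibniz rule.\<close>

inductive_set saturation_set :: "'e ab_mod \<Rightarrow> ('e \<times> nat) set set" for E :: "'e ab_mod" where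
  incl: "x \<in> carrier E \<Longrightarrow> loc_incl E x \<in> saturation_set E"
| add: "u \<in> saturation_set E \<Longrightarrow> v \<in> saturation_set E \<Longrightarrow> u \<oplus>\<^bsub>ab_loc E\<^esub> v \<in> saturation_set E"
| b_inverse_a: "u \<in> saturation_set E \<Longrightarrow> b_inverse_a E u \<in> saturation_set E"

text \<open>Independence of representatives for the sum of two fractions: \<open>n\<close>,
  \<open>n'\<close>, \<open>m\<close>, \<open>m'\<close> stand for powers of b, the other letters
  for values of a form.\<close>

lemma cross_multiplied_add:
  "n * x' = n' * x \<Longrightarrow> m * y' = m' * y \<Longrightarrow>
    n * m * (m' * x' + n' * y') = n' * m' * (m * x + n * (y :: 'r :: comm_ring_1))"
proof -
  assume h: "n * x' = n' * x" "m * y' = m' * y"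
  have "n * m * (m' * x' + n' * y') = m * m' * (n * x') + n * n' * (m * y')"
    by (simp add: algebra_simps)
  thus ?thesis unfolding h by (simp add: algebra_simps)
qed

text \<open>The same for the action of a. Here \<open>n\<close> and \<open>m\<close> stand for
  powers of b and \<open>k\<close> and \<open>l\<close> for their exponents; the first hypothesis
  arises by applying a to the equation of representatives behind the second one.\<close>

lemma cross_multiplied_a_op:
  "n * a' + k * b * n * x' = m * a + l * b * m * x \<Longrightarrow> n * x' = m * x \<Longrightarrow>
    n * (a' - l * (b * x')) = m * (a - k * (b * (x :: 'r :: comm_ring_1)))"
proof -
  assume "n * a' + k * b * n * x' = m * a + l * b * m * x" and h: "n * x' = m * x"
  hence a: "n * a' = m * a + l * b * (m * x) - k * b * (n * x')" by (simp add: algebra_simps)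
  have "n * (a' - l * (b * x')) = n * a' - l * b * (n * x')" by (simp add: algebra_simps)
  thus ?thesis unfolding a h by (simp add: algebra_simps)
qed

lemma fps_X2_deriv_power: "fps_X ^ 2 * fps_deriv (fps_X ^ n) = (of_nat n * fps_X * fps_X ^ n :: complex fps)"
proof (induction n)
  case (Suc n)
  have "fps_X ^ 2 * fps_deriv (fps_X ^ Suc n) =
      fps_X ^ 2 * fps_X ^ n + fps_X * (fps_X ^ 2 * fps_deriv (fps_X ^ n) :: complex fps)"
    by (simp only: power_Suc fps_deriv_mult fps_deriv_fps_X) (simp only: algebra_simps mult_1_left)
  thus ?case unfolding Suc.IH by (simp add: power2_eq_square algebra_simps)
qed simp

section \<open>The localization as a module over C[[b]]\<close>

context ab_module
begin

abbreviation fr where "fr \<equiv> loc_frac E"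
abbreviation L where "L \<equiv> ab_loc E"
abbreviation T where "T \<equiv> b_inverse_a E"

lemma form_minus:
  "lin_form E p \<Longrightarrow> x \<in> carrier E \<Longrightarrow> y \<in> carrier E \<Longrightarrow> p (x \<ominus> y) = p x - p y"
  by (simp add: minus_eq_scale lin_form_add lin_form_smult)

lemma fr_eq_iff:
  assumes x: "x \<in> carrier E" and y: "y \<in> carrier E"
  shows "fr x n = fr y m \<longleftrightarrow> fps_X ^ m \<odot> x = fps_X ^ n \<odot> y"
proof
  have "(y, m) \<in> fr y m" using y by (simp add: loc_frac_def)
  moreover assume "fr x n = fr y m"
  ultimately have "(y, m) \<in> fr x n" by simp
  thus "fps_X ^ m \<odot> x = fps_X ^ n \<odot> y" by (simp add: loc_frac_def)
next
  \<comment> \<open>Transitivity of the relation between pairs; it rests on the absence of b-torsion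
    in E.\<close>
  have sub: "fr x n \<subseteq> fr y m"
    if x: "x \<in> carrier E" and y: "y \<in> carrier E" and eq: "fps_X ^ m \<odot> x = fps_X ^ n \<odot> y" for x y n m
  proof clarify
    fix z k assume "(z, k) \<in> fr x n"
    hence z: "z \<in> carrier E" "fps_X ^ k \<odot> x = fps_X ^ n \<odot> z" by (auto simp: loc_frac_def)
    have "fps_X ^ n \<odot> (fps_X ^ k \<odot> y) = fps_X ^ k \<odot> (fps_X ^ m \<odot> x)"
      using y by (simp add: eq scale_scale mult.commute)
    also have "\<dots> = fps_X ^ m \<odot> (fps_X ^ n \<odot> z)"
      using x by (simp add: z(2)[symmetric] scale_scale mult.commute)
    also have "\<dots> = fps_X ^ n \<odot> (fps_X ^ m \<odot> z)" using z by (simp add: scale_scale mult.commute)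
    finally show "(z, k) \<in> fr y m" using z y X_power_cancel[of "fps_X ^ k \<odot> y" "fps_X ^ m \<odot> z" n]
      by (simp add: loc_frac_def)
  qed
  assume "fps_X ^ m \<odot> x = fps_X ^ n \<odot> y"
  thus "fr x n = fr y m" using sub[OF x y] sub[OF y x] by (intro equalityI) auto
qed

text \<open>Equality of fractions is tested by forms on E, so laws of the localization reduce to
  polynomial identities in powers of b and values of a form.\<close>

lemma fr_eqI:
  assumes "x \<in> carrier E" "y \<in> carrier E" "\<And>p. lin_form E p \<Longrightarrow> fps_X ^ m * p x = fps_X ^ n * p y"
  shows "fr x n = fr y m"
  unfolding fr_eq_iff[OF assms(1,2)]
  by (rule form_eqI) (use assms in \<open>simp_all add: lin_form_smult\<close>)

lemma fr_eq_formD: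
  "fr x n = fr y m \<Longrightarrow> x \<in> carrier E \<Longrightarrow> y \<in> carrier E \<Longrightarrow> lin_form E p \<Longrightarrow> fps_X ^ m * p x = fps_X ^ n * p y"
  by (metis fr_eq_iff lin_form_smult)

lemma mem_fr_iff:
  assumes "x \<in> carrier E"
  shows "(y, m) \<in> fr x n \<longleftrightarrow> y \<in> carrier E \<and> fr y m = fr x n"
proof -
  have "(y, m) \<in> fr x n \<longleftrightarrow> y \<in> carrier E \<and> fps_X ^ m \<odot> x = fps_X ^ n \<odot> y"
    by (simp add: loc_frac_def)
  moreover have "fr y m = fr x n \<longleftrightarrow> fps_X ^ m \<odot> x = fps_X ^ n \<odot> y" if "y \<in> carrier E"
    using fr_eq_iff[OF that assms] by (rule trans) (rule eq_commute)
  ultimately show ?thesis by blast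
qed

text \<open>The operations of \<open>ab_loc\<close> are unions over all representatives; such a
  union collapses as soon as its members agree.\<close>

lemma UN_fr:
  assumes "x \<in> carrier E" "\<And>y m. y \<in> carrier E \<Longrightarrow> fr y m = fr x n \<Longrightarrow> g y m = g x n"
  shows "(\<Union>(y, m)\<in>fr x n. g y m) = g x n"
proof (rule SUP_eq_const)
  have "(x, n) \<in> fr x n" using assms(1) by (simp add: mem_fr_iff)
  thus "fr x n \<noteq> {}" by blast
  fix z assume "z \<in> fr x n"
  thus "(case z of (y, m) \<Rightarrow> g y m) = g x n"
    using assms(2) mem_fr_iff[OF assms(1)] by (cases z) simp
qed

lemma L_carrier: "u \<in> carrier L \<longleftrightarrow> (\<exists>x n. u = fr x n \<and> x \<in> carrier E)"
  by (auto simp: ab_loc_def)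

lemma fr_closed [simp, intro]: "x \<in> carrier E \<Longrightarrow> fr x n \<in> carrier L"
  by (auto simp: L_carrier)

lemma L_zero: "\<zero>\<^bsub>L\<^esub> = fr \<zero> 0"
  by (simp add: ab_loc_def)

lemma L_add:
  assumes x: "x \<in> carrier E" and y: "y \<in> carrier E"
  shows "fr x n \<oplus>\<^bsub>L\<^esub> fr y m = fr (fps_X ^ m \<odot> x \<oplus> fps_X ^ n \<odot> y) (n + m)"
proof -
  let ?g = "\<lambda>x' n' y' m'. fr (fps_X ^ m' \<odot> x' \<oplus> fps_X ^ n' \<odot> y') (n' + m')"
  have g: "?g x' n' y' m' = ?g x n y m"
    if x': "x' \<in> carrier E" "fr x' n' = fr x n" and y': "y' \<in> carrier E" "fr y' m' = fr y m" for x' y' n' m'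
  proof (rule fr_eqI)
    fix p assume p: "lin_form E p"
    have "fps_X ^ n * p x' = fps_X ^ n' * p x" "fps_X ^ m * p y' = fps_X ^ m' * p y"
      using fr_eq_formD[OF x'(2) x'(1) x p] fr_eq_formD[OF y'(2) y'(1) y p] by auto
    from cross_multiplied_add[OF this]
    show "fps_X ^ (n + m) * p (fps_X ^ m' \<odot> x' \<oplus> fps_X ^ n' \<odot> y') =
        fps_X ^ (n' + m') * p (fps_X ^ m \<odot> x \<oplus> fps_X ^ n \<odot> y)"
      using x x'(1) y y'(1) p by (simp add: lin_form_add lin_form_smult power_add)
  qed (use that x y in auto)
  have inner: "(\<Union>(y', m')\<in>fr y m. ?g x' n' y' m') = ?g x n y m"
    if x': "x' \<in> carrier E" "fr x' n' = fr x n" for x' n'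
    using UN_fr[OF y, of m "?g x' n'"] g[OF x'] g[OF x' y refl] by simp
  have "(\<Union>(x', n')\<in>fr x n. \<Union>(y', m')\<in>fr y m. ?g x' n' y' m') = ?g x n y m"
    using UN_fr[OF x, of n "\<lambda>x' n'. \<Union>(y', m')\<in>fr y m. ?g x' n' y' m'"] inner inner[OF x refl] by simp
  thus ?thesis by (simp add: ab_loc_def)
qed

lemma L_smult:
  assumes x: "x \<in> carrier E"
  shows "s \<odot>\<^bsub>L\<^esub> fr x n = fr (s \<odot> x) n"
proof -
  have "(\<Union>(x, n)\<in>fr x n. fr (s \<odot> x) n) = fr (s \<odot> x) n"
  proof (rule UN_fr[OF x])
    fix y m assume y: "y \<in> carrier E" "fr y m = fr x n"
    show "fr (s \<odot> y) m = fr (s \<odot> x) n"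
      by (rule fr_eqI) (use x y fr_eq_formD[OF y(2) y(1) x] in \<open>auto simp: lin_form_smult mult.left_commute\<close>)
  qed
  thus ?thesis by (simp add: ab_loc_def)
qed

lemma a_X_power:
  assumes "x \<in> carrier E"
  shows "a_op E (fps_X ^ n \<odot> x) = fps_X ^ n \<odot> a_op E x \<oplus> (of_nat n * fps_X * fps_X ^ n) \<odot> x"
  using a_leibniz[OF assms, of "fps_X ^ n"] by (simp only: fps_X2_deriv_power)

lemma L_a_op:
  assumes x: "x \<in> carrier E"
  shows "a_op L (fr x n) = fr (a_op E x \<ominus> of_nat n \<odot> b_op E x) n"
proof -
  have "(\<Union>(x, n)\<in>fr x n. fr (a_op E x \<ominus> of_nat n \<odot> b_op E x) n) = fr (a_op E x \<ominus> of_nat n \<odot> b_op E x) n"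
  proof (rule UN_fr[OF x])
    fix y m assume y: "y \<in> carrier E" "fr y m = fr x n"
    show "fr (a_op E y \<ominus> of_nat m \<odot> b_op E y) m = fr (a_op E x \<ominus> of_nat n \<odot> b_op E x) n"
    proof (rule fr_eqI)
      fix p assume p: "lin_form E p"
      have "p (a_op E (fps_X ^ n \<odot> y)) = p (a_op E (fps_X ^ m \<odot> x))"
        using y fr_eq_iff[OF y(1) x] by simp
      hence "fps_X ^ n * p (a_op E y) + of_nat n * fps_X * fps_X ^ n * p y =
          fps_X ^ m * p (a_op E x) + of_nat m * fps_X * fps_X ^ m * p x"
        using x y p by (simp add: a_X_power lin_form_add lin_form_smult a_closed)
      moreover have "fps_X ^ n * p y = fps_X ^ m * p x"
        by (rule fr_eq_formD[OF y(2) y(1) x p])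
      from cross_multiplied_a_op[OF calculation(1) this]
      show "fps_X ^ n * p (a_op E y \<ominus> of_nat m \<odot> b_op E y) =
          fps_X ^ m * p (a_op E x \<ominus> of_nat n \<odot> b_op E x)"
        using x y(1) p by (simp add: form_minus lin_form_smult b_op_def a_closed)
    qed (use x y in \<open>auto simp: b_op_def a_closed\<close>)
  qed
  thus ?thesis by (simp add: ab_loc_def)
qed

lemma T_arg_closed [simp]: "x \<in> carrier E \<Longrightarrow> a_op E x \<ominus> of_nat n \<odot> b_op E x \<in> carrier E"
  by (simp add: b_op_def a_closed)

lemma T_fr:
  assumes x: "x \<in> carrier E"
  shows "T (fr x n) = fr (a_op E x \<ominus> of_nat n \<odot> b_op E x) (Suc n)"
proof -
  let ?y = "a_op E x \<ominus> of_nat n \<odot> b_op E x"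
  have "(\<Union>(x, n)\<in>fr ?y n. fr x (Suc n)) = fr ?y (Suc n)"
  proof (rule UN_fr)
    fix z m assume z: "z \<in> carrier E" "fr z m = fr ?y n"
    have y: "?y \<in> carrier E" using x by simp
    show "fr z (Suc m) = fr ?y (Suc n)"
      by (rule fr_eqI) (use x z(1) fr_eq_formD[OF z(2) z(1) y] in \<open>auto simp: mult.assoc\<close>)
  qed (use x in simp)
  thus ?thesis by (simp add: L_a_op[OF x] b_inverse_a_def loc_b_inverse_def)
qed

lemma L_cases [consumes 1]:
  assumes "u \<in> carrier L"
  obtains x n where "u = fr x n" "x \<in> carrier E"
  using assms L_carrier by blast

lemmas form_simps = form_minus lin_form_add lin_form_smult lin_form_zero b_op_def a_closed a_add form_a_scale

lemma fps_module_L: "fps_module L"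
proof (rule fps_moduleI)
  show "\<zero>\<^bsub>L\<^esub> \<in> carrier L" by (simp add: L_zero)
next
  fix x y assume "x \<in> carrier L" "y \<in> carrier L"
  thus "x \<oplus>\<^bsub>L\<^esub> y \<in> carrier L" by (elim L_cases) (simp add: L_add)
next
  fix s x assume "x \<in> carrier L"
  thus "s \<odot>\<^bsub>L\<^esub> x \<in> carrier L" by (elim L_cases) (simp add: L_smult)
next
  fix x y z assume "x \<in> carrier L" "y \<in> carrier L" "z \<in> carrier L"
  thus "x \<oplus>\<^bsub>L\<^esub> y \<oplus>\<^bsub>L\<^esub> z = x \<oplus>\<^bsub>L\<^esub> (y \<oplus>\<^bsub>L\<^esub> z)"
    by (elim L_cases, simp add: L_add, intro fr_eqI)
      (simp_all add: form_simps power_add algebra_simps)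
next
  fix x y assume "x \<in> carrier L" "y \<in> carrier L"
  thus "x \<oplus>\<^bsub>L\<^esub> y = y \<oplus>\<^bsub>L\<^esub> x"
    by (elim L_cases, simp add: L_add, intro fr_eqI)
      (simp_all add: form_simps power_add algebra_simps)
next
  fix x assume "x \<in> carrier L"
  thus "\<zero>\<^bsub>L\<^esub> \<oplus>\<^bsub>L\<^esub> x = x" "1 \<odot>\<^bsub>L\<^esub> x = x" "0 \<odot>\<^bsub>L\<^esub> x = \<zero>\<^bsub>L\<^esub>"
    by (elim L_cases, simp add: L_add L_zero L_smult fr_eq_iff)+
next
  fix s t x assume "x \<in> carrier L"
  thus "(s + t) \<odot>\<^bsub>L\<^esub> x = s \<odot>\<^bsub>L\<^esub> x \<oplus>\<^bsub>L\<^esub> t \<odot>\<^bsub>L\<^esub> x"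
    by (elim L_cases, simp add: L_add L_smult, intro fr_eqI)
      (simp_all add: form_simps power_add algebra_simps)
next
  fix s x y assume "x \<in> carrier L" "y \<in> carrier L"
  thus "s \<odot>\<^bsub>L\<^esub> (x \<oplus>\<^bsub>L\<^esub> y) = s \<odot>\<^bsub>L\<^esub> x \<oplus>\<^bsub>L\<^esub> s \<odot>\<^bsub>L\<^esub> y"
    by (elim L_cases, simp add: L_add L_smult, intro fr_eqI)
      (simp_all add: form_simps power_add algebra_simps)
next
  fix s t x assume "x \<in> carrier L"
  thus "(s * t) \<odot>\<^bsub>L\<^esub> x = s \<odot>\<^bsub>L\<^esub> (t \<odot>\<^bsub>L\<^esub> x)"
    by (elim L_cases) (simp add: L_smult scale_scale)
qed

interpretation L: fps_module L by (rule fps_module_L)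

lemma T_closed [simp, intro]: "u \<in> carrier L \<Longrightarrow> T u \<in> carrier L"
  by (elim L_cases) (simp add: T_fr)

lemma T_add:
  assumes "u \<in> carrier L" "v \<in> carrier L"
  shows "T (u \<oplus>\<^bsub>L\<^esub> v) = T u \<oplus>\<^bsub>L\<^esub> T v"
  using assms
  by (elim L_cases, simp add: T_fr L_add, intro fr_eqI)
    (simp_all add: form_simps a_X_power power_add algebra_simps)

text \<open>The Leibniz rule divided by b. The correction b s' u has no denominator beyond that of
  u, which keeps the saturation stable under scalars.\<close>

lemma T_smult:
  assumes "u \<in> carrier L"
  shows "T (s \<odot>\<^bsub>L\<^esub> u) = s \<odot>\<^bsub>L\<^esub> T u \<oplus>\<^bsub>L\<^esub> (fps_X * fps_deriv s) \<odot>\<^bsub>L\<^esub> u"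
  using assms
  by (elim L_cases, simp add: T_fr L_add L_smult, intro fr_eqI)
    (simp_all add: form_simps power_add power2_eq_square algebra_simps)

lemma L_a_op_eq: "u \<in> carrier L \<Longrightarrow> a_op L u = fps_X \<odot>\<^bsub>L\<^esub> T u"
  by (elim L_cases, simp add: T_fr L_a_op L_smult, intro fr_eqI)
    (simp_all add: form_simps algebra_simps)

lemma incl_closed [simp]: "x \<in> carrier E \<Longrightarrow> loc_incl E x \<in> carrier L"
  by (auto simp: loc_incl_def)

lemma incl_add: "x \<in> carrier E \<Longrightarrow> y \<in> carrier E \<Longrightarrow> loc_incl E (x \<oplus> y) = loc_incl E x \<oplus>\<^bsub>L\<^esub> loc_incl E y"
  by (simp add: loc_incl_def L_add)

lemma incl_smult: "x \<in> carrier E \<Longrightarrow> loc_incl E (s \<odot> x) = s \<odot>\<^bsub>L\<^esub> loc_incl E x"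
  by (simp add: loc_incl_def L_smult)

lemma incl_a: "x \<in> carrier E \<Longrightarrow> loc_incl E (a_op E x) = a_op L (loc_incl E x)"
  unfolding loc_incl_def by (subst L_a_op, simp, intro fr_eqI) (simp_all add: form_simps)

lemma incl_zero: "loc_incl E \<zero> = \<zero>\<^bsub>L\<^esub>"
  by (simp add: loc_incl_def L_zero)

lemma smult_fr: "x \<in> carrier E \<Longrightarrow> fps_X ^ n \<odot>\<^bsub>L\<^esub> fr x n = loc_incl E x"
  unfolding loc_incl_def by (subst L_smult, simp, intro fr_eqI) (simp_all add: form_simps)

section \<open>The saturation as a C[[b]]-submodule\<close>

lemma saturation_set_closed: "u \<in> saturation_set E \<Longrightarrow> u \<in> carrier L"
  by (induction rule: saturation_set.induct) auto

lemma T_zero: "T \<zero>\<^bsub>L\<^esub> = \<zero>\<^bsub>L\<^esub>"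
  using T_smult[of "\<zero>\<^bsub>L\<^esub>" 0] by simp

text \<open>For \<open>T u\<close> the Leibniz rule is solved for s T(u) = T(s u) - b s' u. The
  induction hypothesis is needed at both \<open>s\<close> and -b s', so the scalar is kept
  arbitrary.\<close>

lemma saturation_set_smult: "u \<in> saturation_set E \<Longrightarrow> s \<odot>\<^bsub>L\<^esub> u \<in> saturation_set E"
proof (induction arbitrary: s rule: saturation_set.induct)
  case (incl x)
  thus ?case by (simp flip: incl_smult add: saturation_set.incl)
next
  case (add u v)
  thus ?case by (simp add: L.scale_add_right saturation_set_closed saturation_set.add)
next
  case (b_inverse_a u)
  have u: "u \<in> carrier L" using b_inverse_a by (simp add: saturation_set_closed)
  have "s \<odot>\<^bsub>L\<^esub> T u = s \<odot>\<^bsub>L\<^esub> T u \<oplus>\<^bsub>L\<^esub> ((fps_X * fps_deriv s) \<odot>\<^bsub>L\<^esub> u \<oplus>\<^bsub>L\<^esub> (- (fps_X * fps_deriv s)) \<odot>\<^bsub>L\<^esub> u)"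
    using u by (simp flip: L.scale_add)
  also have "\<dots> = T (s \<odot>\<^bsub>L\<^esub> u) \<oplus>\<^bsub>L\<^esub> (- (fps_X * fps_deriv s)) \<odot>\<^bsub>L\<^esub> u"
    using u by (simp add: T_smult L.M.a_assoc)
  also have "\<dots> \<in> saturation_set E"
    using b_inverse_a.IH by (intro saturation_set.add saturation_set.b_inverse_a)
  finally show ?case .
qed

lemma T_power_closed: "u \<in> carrier L \<Longrightarrow> (T ^^ k) u \<in> carrier L"
  by (induction k) auto

lemma T_power_add:
  "u \<in> carrier L \<Longrightarrow> v \<in> carrier L \<Longrightarrow> (T ^^ k) (u \<oplus>\<^bsub>L\<^esub> v) = (T ^^ k) u \<oplus>\<^bsub>L\<^esub> (T ^^ k) v"
  by (induction k) (auto simp: T_add T_power_closed)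

lemma T_power_zero: "(T ^^ k) \<zero>\<^bsub>L\<^esub> = \<zero>\<^bsub>L\<^esub>"
  by (induction k) (auto simp: T_zero)

text \<open>The sums of terms T^k x_k already form a set with all closure properties: two sums are
  brought to a common length by zeros and added termwise, and applying T shifts the indices by
  one.\<close>

lemma carrier_saturation: "carrier (saturation E) = saturation_set E"
proof -
  define t where "t x k = (T ^^ k) (loc_incl E (x k))" for x :: "nat \<Rightarrow> 'e" and k
  define S where "S N x = (\<Oplus>\<^bsub>L\<^esub>k\<in>{..N}. t x k)" for N :: nat and x
  have tc: "t x \<in> A \<rightarrow> carrier L" if "x \<in> UNIV \<rightarrow> carrier E" for x and A :: "nat set"
    using that by (auto simp: t_def Pi_iff intro!: T_power_closed)
  have tc': "t x k \<in> carrier L" if "x \<in> UNIV \<rightarrow> carrier E" for x k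
    using tc[OF that, of UNIV] by auto
  have Sc: "S N x \<in> carrier L" if "x \<in> UNIV \<rightarrow> carrier E" for N x
    unfolding S_def by (rule L.finsum_closed[OF tc[OF that]])
  have S0: "S 0 x = t x 0" if "x \<in> UNIV \<rightarrow> carrier E" for x
    unfolding S_def by (rule L.M.finsum_0[OF tc[OF that]])
  have SS: "S (Suc N) x = t x (Suc N) \<oplus>\<^bsub>L\<^esub> S N x" if "x \<in> UNIV \<rightarrow> carrier E" for N x
    unfolding S_def by (rule L.M.finsum_Suc[OF tc[OF that]])
  have tsat: "t x k \<in> saturation_set E" if "x \<in> UNIV \<rightarrow> carrier E" for x k
  proof -
    have "(T ^^ j) (loc_incl E (x k)) \<in> saturation_set E" for j
      by (induction j) (use that in \<open>auto intro!: saturation_set.intros\<close>)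
    thus ?thesis by (simp add: t_def)
  qed
  have "S N x \<in> saturation_set E" if x: "x \<in> UNIV \<rightarrow> carrier E" for N x
    by (induction N) (use x tsat in \<open>auto simp: S0 SS intro!: saturation_set.add\<close>)
  moreover have "\<exists>N x. u = S N x \<and> x \<in> UNIV \<rightarrow> carrier E" if "u \<in> saturation_set E" for u
    using that
  proof (induction rule: saturation_set.induct)
    case (incl x)
    have "loc_incl E x = S 0 (\<lambda>_. x)" using incl by (simp add: S0 t_def)
    thus ?case using incl by (intro exI[of _ 0] exI[of _ "\<lambda>_. x"]) auto
  next
    case (add u v)
    then obtain N x M y where u: "u = S N x" "x \<in> UNIV \<rightarrow> carrier E"
      and v: "v = S M y" "y \<in> UNIV \<rightarrow> carrier E" by auto
    \<comment> \<open>The family is arbitrary beyond \<open>N\<close>, so it is cut off before the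
      sum is lengthened.\<close>
    let ?c = "\<lambda>x N k. if k \<le> N then x k else \<zero>"
    have c: "?c x N \<in> UNIV \<rightarrow> carrier E" if "x \<in> UNIV \<rightarrow> carrier E" for x and N :: nat
      using that by auto
    have pad: "S (N + j) (?c x N) = S N x" if x: "x \<in> UNIV \<rightarrow> carrier E" for N j x
    proof (induction j)
      case 0
      show ?case unfolding S_def add_0_right
        by (rule L.M.finsum_cong') (use tc[OF x] in \<open>auto simp: t_def\<close>)
    next
      case (Suc j)
      have "t (?c x N) (Suc (N + j)) = \<zero>\<^bsub>L\<^esub>" by (simp add: t_def incl_zero T_power_zero T_zero)
      thus ?case using Suc x c[OF x] by (simp add: SS Sc)
    qed
    let ?z = "\<lambda>k. ?c x N k \<oplus> ?c y M k"
    have z: "?z \<in> UNIV \<rightarrow> carrier E" using c[OF u(2)] c[OF v(2)] by (auto simp: Pi_iff)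
    have "u \<oplus>\<^bsub>L\<^esub> v = S (N + M) (?c x N) \<oplus>\<^bsub>L\<^esub> S (N + M) (?c y M)"
      using pad[OF u(2), of N M] pad[OF v(2), of M N] by (simp add: u v add.commute)
    also have "\<dots> = (\<Oplus>\<^bsub>L\<^esub>k\<in>{..N+M}. t (?c x N) k \<oplus>\<^bsub>L\<^esub> t (?c y M) k)"
      unfolding S_def by (rule L.M.finsum_addf[symmetric]) (rule tc c u v)+
    also have "\<dots> = S (N + M) ?z"
      unfolding S_def
    proof (rule L.M.finsum_cong'[OF refl tc[OF z]])
      fix k
      have "?c x N k \<in> carrier E" "?c y M k \<in> carrier E" using c[OF u(2)] c[OF v(2)] by (auto simp: Pi_iff)
      thus "t (?c x N) k \<oplus>\<^bsub>L\<^esub> t (?c y M) k = t ?z k"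
        unfolding t_def by (subst incl_add) (simp_all add: T_power_add)
    qed
    finally show ?case using z by blast
  next
    case (b_inverse_a u)
    then obtain N x where u: "u = S N x" "x \<in> UNIV \<rightarrow> carrier E" by auto
    let ?y = "\<lambda>k. case k of 0 \<Rightarrow> \<zero> | Suc j \<Rightarrow> x j"
    have y: "?y \<in> UNIV \<rightarrow> carrier E" using u(2) by (auto simp: Pi_iff split: nat.split)
    have t0: "t ?y 0 = \<zero>\<^bsub>L\<^esub>" "t ?y (Suc k) = T (t x k)" for k by (simp_all add: t_def incl_zero T_zero)
    have "T (S N x) = S (Suc N) ?y"
    proof (induction N)
      case 0
      show ?case using u y t0 by (simp add: S0 SS tc')
    next
      case (Suc N)
      thus ?case using u y t0 SS[OF u(2), of N] SS[OF y, of "Suc N"] by (simp add: T_add tc' Sc)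
    qed
    thus ?case using y u by blast
  qed
  ultimately have "{S N x | N x. x \<in> UNIV \<rightarrow> carrier E} = saturation_set E" by blast
  thus ?thesis by (simp add: saturation_def S_def t_def b_inverse_a_def[abs_def])
qed

lemma saturation_eq: "saturation E = restrict_carrier L (saturation_set E)"
  using carrier_saturation by (simp add: saturation_def)

lemma saturation_simps [simp]:
  "carrier (saturation E) = saturation_set E" "add (saturation E) = add L"
  "module.smult (saturation E) = module.smult L" "zero (saturation E) = zero L"
  "a_op (saturation E) = a_op L"
  by (simp_all add: saturation_eq)

lemma fps_module_saturation: "fps_module (saturation E)"
  unfolding saturation_eq
proof (rule L.fps_module_restrict, rule L.submodule_restrict)
  show "\<zero>\<^bsub>L\<^esub> \<in> saturation_set E" using saturation_set.incl[of \<zero> E] by (simp add: incl_zero)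
qed (auto simp: saturation_set_closed saturation_set_smult saturation_set.add)

lemma saturation_set_a: "u \<in> saturation_set E \<Longrightarrow> a_op L u \<in> saturation_set E"
  by (simp add: L_a_op_eq saturation_set_closed saturation_set_smult saturation_set.b_inverse_a)

section \<open>Extending linear maps from E to its saturation\<close>

text \<open>The extension of \<open>\<phi>\<close> to \<open>E[b\<^sup>-\<^sup>1]\<close> maps \<open>v\<close> into \<open>G\<close>, with value \<open>g\<close>.\<close>

definition loc_value :: "'c ab_mod \<Rightarrow> ('e \<Rightarrow> 'c) \<Rightarrow> ('e \<times> nat) set \<Rightarrow> 'c \<Rightarrow> bool"
  where "loc_value G \<phi> v g \<longleftrightarrow>
    g \<in> carrier G \<and> (\<forall>x\<in>carrier E. \<forall>n. v = fr x n \<longrightarrow> fps_X ^ n \<odot>\<^bsub>G\<^esub> g = \<phi> x)"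

lemma loc_value_fr: "loc_value G \<phi> (fr x n) g \<Longrightarrow> x \<in> carrier E \<Longrightarrow> fps_X ^ n \<odot>\<^bsub>G\<^esub> g = \<phi> x"
  by (auto simp: loc_value_def)

lemma loc_value_closed: "loc_value G \<phi> v g \<Longrightarrow> g \<in> carrier G"
  by (auto simp: loc_value_def)

context
  fixes G :: "'c ab_mod" and \<phi>
  assumes G: "ab_module G" and phi: "\<phi> \<in> lin_hom E G"
begin

interpretation G: ab_module G by (rule G)

lemma lin_hom_simps:
  "x \<in> carrier E \<Longrightarrow> \<phi> x \<in> carrier G"
  "x \<in> carrier E \<Longrightarrow> y \<in> carrier E \<Longrightarrow> \<phi> (x \<oplus> y) = \<phi> x \<oplus>\<^bsub>G\<^esub> \<phi> y"
  "x \<in> carrier E \<Longrightarrow> \<phi> (s \<odot> x) = s \<odot>\<^bsub>G\<^esub> \<phi> x"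
  using phi by (auto simp: lin_hom_def)

context
  notes [simp] = lin_hom_simps
begin

text \<open>One representative suffices, because \<open>G\<close> has no b-torsion. The same reason
  makes the value unique.\<close>

lemma loc_valueI:
  assumes x: "x \<in> carrier E" and g: "g \<in> carrier G" and eq: "fps_X ^ n \<odot>\<^bsub>G\<^esub> g = \<phi> x"
  shows "loc_value G \<phi> (fr x n) g"
  unfolding loc_value_def
proof (intro conjI ballI allI impI)
  fix y m assume y: "y \<in> carrier E" and "fr x n = fr y m"
  hence "fps_X ^ m \<odot> x = fps_X ^ n \<odot> y" using x by (simp add: fr_eq_iff)
  hence "\<phi> (fps_X ^ m \<odot> x) = \<phi> (fps_X ^ n \<odot> y)" by simp
  hence "fps_X ^ m \<odot>\<^bsub>G\<^esub> (fps_X ^ n \<odot>\<^bsub>G\<^esub> g) = fps_X ^ n \<odot>\<^bsub>G\<^esub> \<phi> y" using x y by (simp add: eq)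
  hence "fps_X ^ n \<odot>\<^bsub>G\<^esub> (fps_X ^ m \<odot>\<^bsub>G\<^esub> g) = fps_X ^ n \<odot>\<^bsub>G\<^esub> \<phi> y"
    using g by (simp add: G.scale_scale mult.commute)
  thus "fps_X ^ m \<odot>\<^bsub>G\<^esub> g = \<phi> y" by (rule G.X_power_cancel[rotated 2]) (use g y in auto)
qed (use g in auto)

lemma loc_value_unique:
  assumes "v \<in> carrier L" "loc_value G \<phi> v g" "loc_value G \<phi> v h"
  shows "g = h"
proof -
  obtain x n where "v = fr x n" "x \<in> carrier E" using assms(1) by (auto simp: L_carrier)
  thus ?thesis using assms(2,3) G.X_power_cancel[of g h n] by (auto simp: loc_value_def)
qed

lemma loc_value_incl: "x \<in> carrier E \<Longrightarrow> loc_value G \<phi> (loc_incl E x) (\<phi> x)"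
  unfolding loc_incl_def by (rule loc_valueI) auto

lemma loc_value_add:
  assumes u: "u \<in> carrier L" "loc_value G \<phi> u g" and v: "v \<in> carrier L" "loc_value G \<phi> v h"
  shows "loc_value G \<phi> (u \<oplus>\<^bsub>L\<^esub> v) (g \<oplus>\<^bsub>G\<^esub> h)"
proof -
  obtain x n y m where uv: "u = fr x n" "v = fr y m" and [simp]: "x \<in> carrier E" "y \<in> carrier E"
    using assms by (auto simp: L_carrier)
  have gh: "g \<in> carrier G" "h \<in> carrier G" "fps_X ^ n \<odot>\<^bsub>G\<^esub> g = \<phi> x" "fps_X ^ m \<odot>\<^bsub>G\<^esub> h = \<phi> y"
    using assms uv by (auto simp: loc_value_def)
  show ?thesis
    unfolding uv by (subst L_add, simp, simp, rule loc_valueI)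
      (use gh in \<open>auto simp: gh(3,4)[symmetric] G.scale_add_right G.scale_scale power_add mult.commute\<close>)
qed

lemma loc_value_smult:
  assumes u: "u \<in> carrier L" "loc_value G \<phi> u g"
  shows "loc_value G \<phi> (s \<odot>\<^bsub>L\<^esub> u) (s \<odot>\<^bsub>G\<^esub> g)"
proof -
  obtain x n where u': "u = fr x n" and [simp]: "x \<in> carrier E"
    using assms by (auto simp: L_carrier)
  have g: "g \<in> carrier G" "fps_X ^ n \<odot>\<^bsub>G\<^esub> g = \<phi> x" using assms u' by (auto simp: loc_value_def)
  show ?thesis
    unfolding u' by (subst L_smult, simp, rule loc_valueI)
      (use g in \<open>auto simp: g(2)[symmetric] G.scale_scale mult.commute\<close>)
qed

text \<open>Since values are unique and compatible with sums and scalars, any choice of values on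
  the saturation is automatically linear.\<close>

lemma loc_value_lin_hom:
  assumes "\<And>v. v \<in> saturation_set E \<Longrightarrow> loc_value G \<phi> v (h v)"
  shows "h \<in> lin_hom (saturation E) G"
proof -
  have "h (u \<oplus>\<^bsub>L\<^esub> v) = h u \<oplus>\<^bsub>G\<^esub> h v" if "u \<in> saturation_set E" "v \<in> saturation_set E" for u v
    by (rule loc_value_unique[OF _ assms loc_value_add])
      (use that assms in \<open>auto intro: saturation_set.add saturation_set_closed\<close>)
  moreover have "h (s \<odot>\<^bsub>L\<^esub> u) = s \<odot>\<^bsub>G\<^esub> h u" if "u \<in> saturation_set E" for s u
    by (rule loc_value_unique[OF _ assms loc_value_smult])
      (use that assms in \<open>auto intro: saturation_set_smult saturation_set_closed\<close>)
  ultimately show ?thesis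
    using assms by (auto simp: lin_hom_def loc_value_def)
qed

end

end

text \<open>The extension of \<phi> still commutes with a, so it sends b^-1 a u to b^-1 a g, which
  is \<open>h\<close>. Only the divisibility of \<open>a g\<close> by b is in question, and a simple
  pole of \<open>G\<close> supplies it.\<close>

lemma loc_value_T:
  assumes G: "ab_module G" and phi: "\<phi> \<in> ab_hom E G" and u: "u \<in> carrier L" "loc_value G \<phi> u g"
    and h: "h \<in> carrier G" "a_op G g = fps_X \<odot>\<^bsub>G\<^esub> h"
  shows "loc_value G \<phi> (T u) h"
proof -
  interpret G: ab_module G by (rule G)
  have phi': "\<phi> \<in> lin_hom E G" "\<And>x. x \<in> carrier E \<Longrightarrow> \<phi> (a_op E x) = a_op G (\<phi> x)"
    using phi by (auto simp: ab_hom_def)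
  note [simp] = lin_hom_simps[OF G phi'(1)]
  obtain x n where u': "u = fr x n" and [simp]: "x \<in> carrier E"
    using u by (auto simp: L_carrier)
  have g: "g \<in> carrier G" "fps_X ^ n \<odot>\<^bsub>G\<^esub> g = \<phi> x" using u u' by (auto simp: loc_value_def)
  \<comment> \<open>The correction for the denominator b^n cancels the term that a produces when it
    passes b^n in front of \<open>g\<close>.\<close>
  have "\<phi> (a_op E x \<ominus> of_nat n \<odot> b_op E x) =
      fps_X ^ n \<odot>\<^bsub>G\<^esub> a_op G g \<oplus>\<^bsub>G\<^esub> (of_nat n * fps_X * fps_X ^ n) \<odot>\<^bsub>G\<^esub> g \<oplus>\<^bsub>G\<^esub>
        (- (of_nat n * fps_X * fps_X ^ n)) \<odot>\<^bsub>G\<^esub> g"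
    using g(1) by (simp add: minus_eq_scale b_op_def a_closed phi'(2) g(2)[symmetric] G.a_X_power G.scale_scale mult.assoc)
  also have "\<dots> = fps_X ^ Suc n \<odot>\<^bsub>G\<^esub> h"
    using g(1) h(1) by (simp add: G.M.a_assoc G.a_closed flip: G.scale_add)
      (simp add: h(2) G.scale_scale mult.commute)
  finally show ?thesis
    unfolding u' T_fr[OF \<open>x \<in> carrier E\<close>]
    by (intro loc_valueI[OF G phi'(1)] T_arg_closed h) simp_all
qed

text \<open>The simple pole of \<open>G\<close> means stability under b^-1 a, so an embedding of E
  in \<open>G\<close> extends to the saturation without leaving \<open>G\<close>. The extension is
  still injective, and freeness descends along it.\<close>

lemma free_saturation:
  assumes "regular E"
  shows "free_of_finite_rank (saturation E)"
proof -
  obtain G :: "(nat \<Rightarrow> complex fps) ab_mod" and f where G: "ab_module G" and sp: "simple_pole G"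
    and f: "f \<in> ab_hom E G" and inj: "inj_on f (carrier E)"
    using assms by (auto simp: regular_def)
  interpret G: ab_module G by (rule G)
  have fl: "f \<in> lin_hom E G" using f by (simp add: ab_hom_def)
  note [simp] = lin_hom_simps[OF G fl]
  have "\<exists>g. loc_value G f v g" if "v \<in> saturation_set E" for v
    using that
  proof (induction rule: saturation_set.induct)
    case (incl x)
    thus ?case using loc_value_incl[OF G fl] by blast
  next
    case (add u v)
    thus ?case using loc_value_add[OF G fl] saturation_set_closed by blast
  next
    case (b_inverse_a u)
    then obtain g where g: "loc_value G f u g" by blast
    then obtain h where "h \<in> carrier G" "a_op G g = fps_X \<odot>\<^bsub>G\<^esub> h"
      using sp loc_value_closed[OF g] by (auto simp: simple_pole_def b_op_def)
    thus ?case using loc_value_T[OF G f _ g] b_inverse_a.hyps saturation_set_closed by blast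
  qed
  then obtain h where h: "\<And>v. v \<in> saturation_set E \<Longrightarrow> loc_value G f v (h v)" by metis
  have hl: "h \<in> lin_hom (saturation E) G" by (rule loc_value_lin_hom[OF G fl h])
  have "inj_on h (saturation_set E)"
  proof (rule inj_onI)
    fix u v assume uv: "u \<in> saturation_set E" "v \<in> saturation_set E" "h u = h v"
    then obtain x n y m where u: "u = fr x n" "x \<in> carrier E" and v: "v = fr y m" "y \<in> carrier E"
      using saturation_set_closed by (meson L_carrier)
    have eq: "fps_X ^ n \<odot>\<^bsub>G\<^esub> h u = f x" "fps_X ^ m \<odot>\<^bsub>G\<^esub> h u = f y" "h u \<in> carrier G"
      using h[OF uv(1)] h[OF uv(2)] uv(3) u v loc_value_fr loc_value_closed by metis+
    \<comment> \<open>Both sides are b^(n+m) times the common value \<open>h u\<close>.\<close>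
    have "f (fps_X ^ m \<odot> x) = f (fps_X ^ n \<odot> y)"
      using u v eq(3) by (simp add: eq(1,2)[symmetric] G.scale_scale mult.commute)
    hence "fps_X ^ m \<odot> x = fps_X ^ n \<odot> y" by (rule inj_onD[OF inj]) (use u v in auto)
    thus "u = v" using u v by (simp add: fr_eq_iff)
  qed
  thus ?thesis
    using free_of_injective[OF fps_module_saturation G.fps_module_axioms G.free hl] by simp
qed

lemma ab_module_saturation:
  assumes "regular E"
  shows "ab_module (saturation E)"
proof (rule ab_moduleI[OF fps_module_saturation free_saturation[OF assms]])
  fix s u assume "u \<in> carrier (saturation E)"
  hence "u \<in> carrier L" by (simp add: saturation_set_closed)
  thus "a_op (saturation E) (s \<odot>\<^bsub>saturation E\<^esub> u) = s \<odot>\<^bsub>saturation E\<^esub> a_op (saturation E) u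
      \<oplus>\<^bsub>saturation E\<^esub> (fps_X ^ 2 * fps_deriv s) \<odot>\<^bsub>saturation E\<^esub> u"
    by (simp add: L_a_op_eq T_smult L.scale_add_right L.scale_scale power2_eq_square mult.commute mult.left_commute)
qed (auto simp: saturation_set_a L_a_op_eq T_add L.scale_add_right saturation_set_closed
    saturation_set_smult saturation_set.b_inverse_a)

end

section \<open>Extending the duality to the saturation\<close>

text \<open>\<open>F\<close> depends on E alone and not on the pairing, so \<kappa> and its
  transpose are both instances with the same \<open>F\<close>.\<close>

locale self_dual = ab_duality E E \<delta> \<kappa> for E :: "'e ab_mod" and \<delta> \<kappa> +
  fixes F :: "'e set"
  assumes regular: "regular E"
    and biggest: "biggest_simple_pole_sub F E"
begin

abbreviation S where "S \<equiv> saturation_set E"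
abbreviation "T \<equiv> b_inverse_a E"
abbreviation "R \<equiv> ab_rank1 \<delta>"

lemma F_sub: "sub_ab_module F E"
  and F_simple: "u \<in> F \<Longrightarrow> \<exists>w\<in>F. a_op E u = fps_X \<odot>\<^bsub>E\<^esub> w"
  and F_max: "sub_ab_module F' E \<Longrightarrow> simple_pole (restrict_carrier E F') \<Longrightarrow> F' \<subseteq> F"
  using biggest by (auto simp: biggest_simple_pole_sub_def simple_pole_def b_op_def)

lemma F_carrier: "u \<in> F \<Longrightarrow> u \<in> carrier E"
  and F_add: "u \<in> F \<Longrightarrow> v \<in> F \<Longrightarrow> u \<oplus>\<^bsub>E\<^esub> v \<in> F"
  and F_smult: "u \<in> F \<Longrightarrow> s \<odot>\<^bsub>E\<^esub> u \<in> F"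
  and F_a: "u \<in> F \<Longrightarrow> a_op E u \<in> F"
  using F_sub M.submoduleE[of F] unfolding sub_ab_module_def by auto

lemma kappa_hom: "u \<in> carrier E \<Longrightarrow> \<kappa> u \<in> lin_hom E R"
  by (simp add: lin_hom_ab_rank1 form)

abbreviation "val u \<equiv> M.loc_value R (\<kappa> u)"

lemma val_fr: "val u (loc_frac E x n) s \<Longrightarrow> x \<in> carrier E \<Longrightarrow> fps_X ^ n * s = \<kappa> u x"
  using M.loc_value_fr[of R "\<kappa> u" x n s] by simp

lemma valI: "u \<in> carrier E \<Longrightarrow> x \<in> carrier E \<Longrightarrow> fps_X ^ n * s = \<kappa> u x \<Longrightarrow> val u (loc_frac E x n) s"
  using M.loc_valueI[OF ab_module_ab_rank1 kappa_hom, of u x s n] by simp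

lemma val_exists:
  assumes "v \<in> S" "u \<in> F"
  shows "\<exists>s. val u v s"
  using assms
proof (induction arbitrary: u rule: saturation_set.induct)
  case (incl x)
  thus ?case by (blast intro: M.loc_value_incl[OF ab_module_ab_rank1 kappa_hom] F_carrier)
next
  case (add v w)
  then obtain s t where "val u v s" "val u w t" by blast
  hence "val u (v \<oplus>\<^bsub>M.L\<^esub> w) (s \<oplus>\<^bsub>R\<^esub> t)"
    using add.hyps add.prems
    by (intro M.loc_value_add[OF ab_module_ab_rank1 kappa_hom] F_carrier M.saturation_set_closed)
  thus ?case ..
next
  case (b_inverse_a v u)
  obtain x n where v: "v = loc_frac E x n" and x: "x \<in> carrier E"
    by (rule M.L_cases[OF M.saturation_set_closed[OF b_inverse_a.hyps]])
  obtain w where w: "w \<in> F" "a_op E u = fps_X \<odot>\<^bsub>E\<^esub> w" using F_simple b_inverse_a.prems by blast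
  \<comment> \<open>The hypothesis is used for \<open>w\<close>, which is b^-1 a u, as well as for
    \<open>u\<close>; this is why \<open>u\<close> varies in the induction.\<close>
  obtain s t where s: "val u v s" and t: "val w v t"
    using b_inverse_a.IH b_inverse_a.prems w(1) by blast
  note uw = F_carrier[OF b_inverse_a.prems] F_carrier[OF w(1)]
  have "\<kappa> u (a_op E x) = a_op R (\<kappa> u x) + \<kappa> (a_op E u) x" using a[of u x] uw x by simp
  also have "\<dots> = a_op R (fps_X ^ n * s) - fps_X * (fps_X ^ n * t)"
    using val_fr[OF s[unfolded v] x] val_fr[OF t[unfolded v] x] uw x by (simp add: w(2) smult)
  also have "\<dots> = fps_X ^ n * a_op R s + of_nat n * fps_X * fps_X ^ n * s - fps_X * (fps_X ^ n * t)"
    by (simp only: ab_rank1_a_op_simps fps_X2_deriv_power)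
  finally have k: "\<kappa> u (a_op E x) = \<dots>" .
  have "\<kappa> u (a_op E x \<ominus>\<^bsub>E\<^esub> of_nat n \<odot>\<^bsub>E\<^esub> b_op E x) = \<kappa> u (a_op E x) - of_nat n * (fps_X * \<kappa> u x)"
    using uw x by (simp add: M.form_minus[OF form] b_op_def M.a_closed form_smult)
  \<comment> \<open>The terms with factor n cancel. The new value is b^-1 a s - t, with a acting as
    on E_\<delta>; the sign of \<open>t\<close> comes from b acting as -b in the first
    argument.\<close>
  also have "\<dots> = fps_X ^ Suc n * (fps_const \<delta> * s + fps_X * fps_deriv s - t)"
    unfolding k val_fr[OF s[unfolded v] x, symmetric] ab_rank1_a_op
    by (simp add: algebra_simps power2_eq_square)
  finally show ?case
    unfolding v M.T_fr[OF x]
    by (intro exI[of _ "fps_const \<delta> * s + fps_X * fps_deriv s - t"] valI[OF uw(1) M.T_arg_closed[OF x]])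
      (rule sym)
qed

definition extend :: "'e \<Rightarrow> ('e \<times> nat) set \<Rightarrow> complex fps"
  where "extend u v = (SOME s. val u v s)"

lemma extend: "u \<in> F \<Longrightarrow> v \<in> S \<Longrightarrow> val u v (extend u v)"
  unfolding extend_def by (rule someI_ex) (rule val_exists)

lemma extend_fr:
  "u \<in> F \<Longrightarrow> loc_frac E x n \<in> S \<Longrightarrow> x \<in> carrier E \<Longrightarrow> fps_X ^ n * extend u (loc_frac E x n) = \<kappa> u x"
  by (rule val_fr[OF extend])

lemma extend_incl: "u \<in> F \<Longrightarrow> x \<in> carrier E \<Longrightarrow> extend u (loc_incl E x) = \<kappa> u x"
  using extend_fr[of u x 0] saturation_set.incl[of x E] by (simp add: loc_incl_def)

lemma S_cases:
  assumes "v \<in> S"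
  obtains x n where "v = loc_frac E x n" "x \<in> carrier E"
  by (rule M.L_cases[OF M.saturation_set_closed[OF assms]]) (rule that)

text \<open>Clearing the denominator shows that a form on the saturation is determined by its
  restriction to E.\<close>

lemma lin_form_saturation_fr:
  assumes "lin_form (saturation E) \<Phi>" "loc_frac E x n \<in> S" "x \<in> carrier E"
  shows "fps_X ^ n * \<Phi> (loc_frac E x n) = \<Phi> (loc_incl E x)"
  using lin_form_smult[OF assms(1), of "loc_frac E x n" "fps_X ^ n"] assms by (simp add: M.smult_fr)

lemma lin_form_saturation_incl:
  assumes "lin_form (saturation E) \<Phi>"
  shows "lin_form E (\<lambda>x. \<Phi> (loc_incl E x))"
  by (rule lin_formI)
    (use lin_form_add[OF assms] lin_form_smult[OF assms] in
      \<open>simp_all add: M.incl_add M.incl_smult saturation_set.incl\<close>)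

text \<open>
  The elements \<open>u\<close> for which \<open>\<kappa> u\<close> extends to the saturation form a simple pole submodule, because
  \<open>b\<^sup>-\<^sup>1 a\<close> acts on the forms on the saturation.
\<close>

lemma extendable_in_F:
  assumes "u \<in> carrier E" "lin_form (saturation E) \<Phi>" "\<And>x. x \<in> carrier E \<Longrightarrow> \<Phi> (loc_incl E x) = \<kappa> u x"
  shows "u \<in> F"
proof -
  define F' where "F' = {u \<in> carrier E. \<exists>\<Phi>. lin_form (saturation E) \<Phi> \<and>
    (\<forall>x\<in>carrier E. \<Phi> (loc_incl E x) = \<kappa> u x)}"
  have sm: "s \<odot>\<^bsub>E\<^esub> u \<in> F'" if uF: "u \<in> F'" for s u
  proof -
    obtain \<Phi> where u: "u \<in> carrier E" and \<Phi>: "lin_form (saturation E) \<Phi>"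
      and eq: "\<forall>x\<in>carrier E. \<Phi> (loc_incl E x) = \<kappa> u x"
      using uF unfolding F'_def by blast
    have "lin_form (saturation E) (\<lambda>v. conj_fps s * \<Phi> v)"
      using \<Phi> by (simp add: lin_form_def algebra_simps)
    thus ?thesis using u eq by (auto simp: F'_def smult)
  qed
  have add': "u \<oplus>\<^bsub>E\<^esub> w \<in> F'" if uw: "u \<in> F'" "w \<in> F'" for u w
  proof -
    obtain \<Phi> where u: "u \<in> carrier E" and \<Phi>: "lin_form (saturation E) \<Phi>"
      and eq: "\<forall>x\<in>carrier E. \<Phi> (loc_incl E x) = \<kappa> u x"
      using uw(1) unfolding F'_def by blast
    obtain \<Psi> where w: "w \<in> carrier E" and \<Psi>: "lin_form (saturation E) \<Psi>"
      and eq': "\<forall>x\<in>carrier E. \<Psi> (loc_incl E x) = \<kappa> w x"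
      using uw(2) unfolding F'_def by blast
    have "lin_form (saturation E) (\<lambda>v. \<Phi> v + \<Psi> v)"
      using \<Phi> \<Psi> by (simp add: lin_form_def algebra_simps)
    thus ?thesis using u w eq eq' by (auto simp: F'_def add)
  qed
  have zero: "\<zero>\<^bsub>E\<^esub> \<in> F'"
  proof -
    have "lin_form (saturation E) (\<lambda>_. 0)" by (simp add: lin_form_def)
    moreover have "\<kappa> \<zero>\<^bsub>E\<^esub> x = 0" if "x \<in> carrier E" for x using smult[of "\<zero>\<^bsub>E\<^esub>" x 0] that by simp
    ultimately show ?thesis by (auto simp: F'_def)
  qed
  have pole: "\<exists>w\<in>F'. a_op E u = fps_X \<odot>\<^bsub>E\<^esub> w" if uF: "u \<in> F'" for u
  proof -
    obtain \<Phi> where u: "u \<in> carrier E" and \<Phi>: "lin_form (saturation E) \<Phi>"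
      and eq: "\<forall>x\<in>carrier E. \<Phi> (loc_incl E x) = \<kappa> u x"
      using uF unfolding F'_def by blast
    \<comment> \<open>This is b^-1 times the action of a on \<Phi> as a form, since a v = b T(v). It
      is linear because the terms b s' \<Phi>(v) cancel.\<close>
    define \<Psi> where "\<Psi> v = fps_const \<delta> * \<Phi> v + fps_X * fps_deriv (\<Phi> v) - \<Phi> (T v)" for v
    have \<Psi>: "lin_form (saturation E) \<Psi>"
      by (rule lin_formI)
        (use lin_form_add[OF \<Phi>] lin_form_smult[OF \<Phi>] in \<open>simp_all add: \<Psi>_def M.T_add M.T_smult
          M.saturation_set_closed M.saturation_set_smult saturation_set.b_inverse_a algebra_simps\<close>)
    obtain w where w: "w \<in> carrier E" and kw: "\<forall>x\<in>carrier E. \<kappa> w x = \<Psi> (loc_incl E x)"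
      using surj[OF lin_form_saturation_incl[OF \<Psi>]] by blast
    have "\<kappa> (a_op E u) x = \<kappa> (fps_X \<odot>\<^bsub>E\<^esub> w) x" if x: "x \<in> carrier E" for x
    proof -
      have i: "loc_incl E x \<in> S" by (rule saturation_set.incl[OF x])
      have "\<Phi> (loc_incl E (a_op E x)) = fps_X * \<Phi> (T (loc_incl E x))"
        using lin_form_smult[OF \<Phi>, of "T (loc_incl E x)" fps_X] i x
        by (simp add: M.incl_a M.L_a_op_eq saturation_set.b_inverse_a)
      hence "\<kappa> u (a_op E x) = fps_X * \<Phi> (T (loc_incl E x))" using eq x M.a_closed by simp
      hence "\<kappa> (a_op E u) x = fps_X * \<Phi> (T (loc_incl E x)) - a_op R (\<kappa> u x)"
        using a[of u x] u x by simp
      \<comment> \<open>The pairing with b w is -b times the pairing with \<open>w\<close>, so this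
        minus sign gives a u = b w without a sign.\<close>
      also have "\<dots> = - (fps_X * \<Psi> (loc_incl E x))"
        using eq x by (simp add: \<Psi>_def ab_rank1_a_op algebra_simps power2_eq_square)
      finally show ?thesis using w x kw by (simp add: smult)
    qed
    hence "a_op E u = fps_X \<odot>\<^bsub>E\<^esub> w" using inj u w M.a_closed by simp
    moreover have "w \<in> F'" using w kw \<Psi> by (auto simp: F'_def)
    ultimately show ?thesis by blast
  qed
  have sub: "sub_ab_module F' E"
    unfolding sub_ab_module_def
  proof
    show "submodule F' fps_ring E"
      by (rule M.submodule_restrict) (use zero add' sm in \<open>auto simp: F'_def\<close>)
    show "a_op E ` F' \<subseteq> F'" using pole sm by force
  qed
  moreover have "simple_pole (restrict_carrier E F')"
    using pole by (force simp: simple_pole_def b_op_def)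
  ultimately have "F' \<subseteq> F" by (rule F_max)
  thus ?thesis using assms unfolding F'_def by blast
qed

text \<open>Each identity is multiplied by b^n to reach E, where it holds for \<kappa>, and then b^n
  is cancelled. Injectivity already holds after restriction to E. For surjectivity, the restriction
  of a form to E is represented by some \<open>u\<close>, and \<open>extendable_in_F\<close> places
  \<open>u\<close> in \<open>F\<close>.\<close>

lemma duality: "ab_duality (restrict_carrier E F) (saturation E) \<delta> extend"
proof -
  interpret F: ab_module "restrict_carrier E F"
    by (rule ab_module_restrict_carrier[OF M.ab_module_axioms F_sub])
  interpret St: ab_module "saturation E" by (rule M.ab_module_saturation[OF regular])
  have cancel: "s = t" if "fps_X ^ n * s = fps_X ^ n * (t :: complex fps)" for n s t
    using that by simp
  show ?thesis
  proof (intro_locales, unfold_locales)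
    fix u assume u: "u \<in> carrier (restrict_carrier E F)"
    hence "extend u \<in> lin_hom (saturation E) R"
      using extend F_carrier by (intro M.loc_value_lin_hom[OF ab_module_ab_rank1 kappa_hom[of u]]) auto
    thus "lin_form (saturation E) (extend u)" by (simp add: lin_hom_ab_rank1)
    {
      fix w v assume w: "w \<in> carrier (restrict_carrier E F)" and v: "v \<in> carrier (saturation E)"
      obtain x n where v': "v = loc_frac E x n" "x \<in> carrier E" using v by (auto elim: S_cases)
      have "fps_X ^ n * extend (u \<oplus>\<^bsub>E\<^esub> w) v = fps_X ^ n * (extend u v + extend w v)"
        using u w v extend_fr[of _ x n] F_add F_carrier by (simp add: v' add distrib_left)
      thus "extend (u \<oplus>\<^bsub>restrict_carrier E F\<^esub> w) v = extend u v + extend w v"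
        using cancel by simp
    }
    fix v assume v: "v \<in> carrier (saturation E)"
    obtain x n where v': "v = loc_frac E x n" "x \<in> carrier E" using v by (auto elim: S_cases)
    {
      fix s
      have "fps_X ^ n * extend (s \<odot>\<^bsub>E\<^esub> u) v = fps_X ^ n * (conj_fps s * extend u v)"
        using u v extend_fr[of _ x n] F_smult F_carrier by (simp add: v' smult mult.left_commute)
      thus "extend (s \<odot>\<^bsub>restrict_carrier E F\<^esub> u) v = conj_fps s * extend u v"
        using cancel by simp
    }
    \<comment> \<open>The denominator contributes the same term with factor n on both sides: here by
      the Leibniz rule in C[[b]], below by the action of a on the fraction \<open>v\<close>.\<close>
    have "fps_X ^ n * a_op R (extend u v) + of_nat n * fps_X * fps_X ^ n * extend u v =
        a_op R (fps_X ^ n * extend u v)"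
      by (simp only: ab_rank1_a_op_simps fps_X2_deriv_power)
    also have "\<dots> = \<kappa> u (a_op E x) - \<kappa> (a_op E u) x"
      using u v extend_fr[of u x n] F_carrier v' a[of u x] by simp
    also have "\<kappa> (a_op E u) x = fps_X ^ n * extend (a_op E u) v"
      using u v extend_fr[of "a_op E u" x n] F_a v' by simp
    also have "\<kappa> u (a_op E x) = fps_X ^ n * extend u (a_op M.L v) + of_nat n * fps_X * fps_X ^ n * extend u v"
    proof -
      have "fps_X ^ n * extend u (a_op M.L v) = \<kappa> u (a_op E x \<ominus>\<^bsub>E\<^esub> of_nat n \<odot>\<^bsub>E\<^esub> b_op E x)"
        using u v v' M.saturation_set_a[of v] extend_fr[of u "a_op E x \<ominus>\<^bsub>E\<^esub> of_nat n \<odot>\<^bsub>E\<^esub> b_op E x" n]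
        by (simp add: M.L_a_op)
      also have "\<dots> = \<kappa> u (a_op E x) - of_nat n * (fps_X * (fps_X ^ n * extend u v))"
        using u v v' extend_fr[of u x n] F_carrier
        by (simp add: M.form_minus[OF form] b_op_def M.a_closed form_smult)
      finally show ?thesis by (simp add: mult.assoc)
    qed
    finally have "fps_X ^ n * a_op R (extend u v) = fps_X ^ n * (extend u (a_op M.L v) - extend (a_op E u) v)"
      by (simp add: algebra_simps)
    thus "a_op R (extend u v) = extend u (a_op (saturation E) v) - extend (a_op (restrict_carrier E F) u) v"
      using cancel by simp
  next
    fix u w assume uw: "u \<in> carrier (restrict_carrier E F)" "w \<in> carrier (restrict_carrier E F)"
      and eq: "\<And>v. v \<in> carrier (saturation E) \<Longrightarrow> extend u v = extend w v"
    have "\<kappa> u x = \<kappa> w x" if "x \<in> carrier E" for x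
      using eq[of "loc_incl E x"] that uw extend_incl saturation_set.incl[OF that] by simp
    thus "u = w" using inj uw F_carrier by simp
  next
    fix \<Phi> assume \<Phi>: "lin_form (saturation E) \<Phi>"
    obtain u where u: "u \<in> carrier E" "\<forall>x\<in>carrier E. \<kappa> u x = \<Phi> (loc_incl E x)"
      using surj[OF lin_form_saturation_incl[OF \<Phi>]] by blast
    have uF: "u \<in> F" by (rule extendable_in_F[OF u(1) \<Phi>]) (use u in simp)
    have "extend u v = \<Phi> v" if vS: "v \<in> carrier (saturation E)" for v
    proof -
      obtain x n where v: "v = loc_frac E x n" "x \<in> carrier E" using vS by (auto elim: S_cases)
      have "fps_X ^ n * extend u v = fps_X ^ n * \<Phi> v"
        using extend_fr[OF uF] lin_form_saturation_fr[OF \<Phi>] v vS u by simp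
      thus ?thesis by (rule cancel)
    qed
    thus "\<exists>u\<in>carrier (restrict_carrier E F). \<forall>v\<in>carrier (saturation E). extend u v = \<Phi> v"
      using uF by auto
  qed
qed

end

theorem proposition3p0p5:
  fixes E :: "'e ab_mod" and \<delta> :: complex and \<kappa> :: "'e \<Rightarrow> 'e \<Rightarrow> complex fps" and F :: "'e set"
  assumes "ab_module E"
    and "regular E"
    and "ab_iso (ab_check E) (ab_Hom E (ab_rank1 \<delta>)) \<kappa>"
    and "biggest_simple_pole_sub F E"
  shows "(\<exists>\<kappa>'. ab_iso (ab_check (saturation E)) (ab_Hom (restrict_carrier E F) (ab_rank1 \<delta>)) \<kappa>' \<and>
             (\<forall>x\<in>carrier E. \<kappa>' (loc_incl E x) = restrict (\<kappa> x) F)) \<and>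
         (\<exists>\<kappa>''. ab_iso (ab_check (restrict_carrier E F)) (ab_Hom (saturation E) (ab_rank1 \<delta>)) \<kappa>'' \<and>
             (\<forall>u\<in>F. \<forall>x\<in>carrier E. \<kappa>'' u (loc_incl E x) = \<kappa> u x))"
proof
  interpret ab_duality E E \<delta> \<kappa> by (rule ab_duality_of_iso[OF assms(1,1,3)])
  interpret S: self_dual E \<delta> \<kappa> F by unfold_locales (rule assms)+
  interpret t: ab_duality E E \<delta> "\<lambda>n m. conj_fps (\<kappa> m n)" by (rule transpose)
  interpret St: self_dual E \<delta> "\<lambda>n m. conj_fps (\<kappa> m n)" F by unfold_locales (rule assms)+
  show "\<exists>\<kappa>''. ab_iso (ab_check (restrict_carrier E F)) (ab_Hom (saturation E) (ab_rank1 \<delta>)) \<kappa>'' \<and>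
      (\<forall>u\<in>F. \<forall>x\<in>carrier E. \<kappa>'' u (loc_incl E x) = \<kappa> u x)"
    by (intro exI conjI, rule ab_duality.iso[OF S.duality])
      (simp add: S.extend_incl saturation_set.incl)
  \<comment> \<open>Transposing before and after the extension conjugates twice, so on the image of
    \<open>x\<close> the resulting form takes the values \<open>\<kappa> x u\<close> for
    \<open>u\<close> in \<open>F\<close>.\<close>
  show "\<exists>\<kappa>'. ab_iso (ab_check (saturation E)) (ab_Hom (restrict_carrier E F) (ab_rank1 \<delta>)) \<kappa>' \<and>
      (\<forall>x\<in>carrier E. \<kappa>' (loc_incl E x) = restrict (\<kappa> x) F)"
    by (intro exI conjI, rule ab_duality.iso[OF ab_duality.transpose[OF St.duality]])
      (simp add: St.extend_incl restrict_def fun_eq_iff)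
qed

end
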